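(* For every ordinal $\alpha$, every bounded subset of $\overline{\mathbb{R}}_\alpha$ has a supremum and an infimum, and these belong to $\overline{\mathbb{R}}_\alpha$.
   Context: For an ordinal $\alpha$, let $\mathbb{N}_\alpha$ be the set of ordinals strictly less than $\omega^{\omega^\alpha}$ with the ordinal order and the natural (Hessenberg) sum and product (computed coefficientwise on Cantor normal forms, exponents of products being natural sums of exponents). Let $\mathbb{Z}_\alpha$ be the classes of pairs $(a,b)\in\mathbb{N}_\alpha^2$ under $(a,b)\sim(c,d)\iff a+d=b+c$, with $(a,b)+(c,d)=(a+c,b+d)$, $(a,b)(c,d)=(ac+bd,ad+bc)$, order $[(a_1,a_2)]\ge[(b_1,b_2)]\iff a_1+b_2\ge a_2+b_1$. Let $\mathbb{Q}_\alpha$ be the field of fractions: classes of $(a,b)$, $a\in\mathbb{Z}_\alpha$, $b\in\mathbb{Z}_\alpha\setminus\{0\}$, under $ad=bc$, with the usual fraction operations, and order $A\ge0$ iff $ab\ge0$ for representatives, $A\ge B$ iff $A-B\ge 0$; it is a linearly ordered set. A Dedekind cut on a linearly ordered set $Q$ is a pair $(A,B)$ of subsets of $Q$ such that: every element of $A$ is less than every element of $B$; $Q\setminus(A\cup B)$ has at most one element; $\inf(B)\notin B$ and $\sup(A)\notin A$; and $A\cap B=\varnothing$. Cuts are ordered by $(A_1,B_1)\ge(A_2,B_2)\iff A_2\subseteq A_1$. $\overline{\mathbb{R}}_\alpha$ denotes the set of all Dedekind cuts on $\mathbb{Q}_\alpha$ with this order.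
   Formalization: A Dedekind cut (A,B) is additionally required to have A closed downward and B closed upward in Q; without this the point outside A ∪ B may lie inside A or B, and bounded sets of cuts can fail to have an infimum (already for α = 0). *)

theory Defs
  imports "HOL-Library.Poly_Mapping" "HOL-Library.Multiset_Order" "HOL-Algebra.Order"
begin

section \<open>Ordinals below a power of omega\<close>

text \<open>
  An ordinal is represented by a well-order \<open>s\<close> (up to isomorphism), and the ordinals below it by
  the elements of \<^term>\<open>Field s\<close>.  The following is the ordinal power \<open>\<omega>\<^sup>s\<close>: an ordinal below
  \<open>\<omega>\<^sup>s\<close> is given by its Cantor normal form, i.e. by the finitely supported map \<open>f\<close> sending an
  exponent \<open>x\<close> below \<open>s\<close> to the coefficient of \<open>\<omega>\<^sup>x\<close>, and two such ordinals are compared at the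
  largest exponent at which their coefficients differ.
\<close>

abbreviation coef :: "('a \<Rightarrow>\<^sub>0 'b::zero) \<Rightarrow> 'a \<Rightarrow> 'b" where "coef \<equiv> Poly_Mapping.lookup"

definition omega_exp :: "'a rel \<Rightarrow> ('a \<Rightarrow>\<^sub>0 nat) rel" where
  "omega_exp s = {(f, g). Poly_Mapping.keys f \<subseteq> Field s \<and> Poly_Mapping.keys g \<subseteq> Field s \<and>
     (f = g \<or> (\<exists>x. coef f x < coef g x \<and> (\<forall>y. coef f y \<noteq> coef g y \<longrightarrow> (y, x) \<in> s)))}"

lemma Field_omega_exp: "Field (omega_exp s) = {f. Poly_Mapping.keys f \<subseteq> Field s}"
  by (auto simp: omega_exp_def Field_def)

lemma omega_exp_max_diff:
  assumes s: "Well_order s" and f: "Poly_Mapping.keys f \<subseteq> Field s"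
    and g: "Poly_Mapping.keys g \<subseteq> Field s" and ne: "f \<noteq> g"
  obtains x where "coef f x \<noteq> coef g x" "\<And>y. coef f y \<noteq> coef g y \<Longrightarrow> (y, x) \<in> s"
proof -
  have lin: "Linear_order s" using s by (simp add: well_order_on_def)
  let ?D = "{y. coef f y \<noteq> coef g y}"
  have sub: "?D \<subseteq> Poly_Mapping.keys f \<union> Poly_Mapping.keys g" by (auto simp: Poly_Mapping.in_keys_iff)
  have fin: "finite ?D" by (rule finite_subset[OF sub]) simp
  have F: "?D \<subseteq> Field s" using sub f g by blast
  have "?D \<noteq> {}" using ne by (auto simp: poly_mapping_eq_iff fun_eq_iff)
  moreover have "finite E \<Longrightarrow> E \<noteq> {} \<Longrightarrow> E \<subseteq> Field s \<Longrightarrow> \<exists>x\<in>E. \<forall>y\<in>E. (y, x) \<in> s" for E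
  proof (induction rule: finite_ne_induct)
    case (singleton x)
    then show ?case using lin by (auto simp: order_on_defs refl_on_def)
  next
    case (insert a E)
    then obtain x where x: "x \<in> E" "\<forall>y\<in>E. (y, x) \<in> s" by auto
    show ?case
    proof (cases "(a, x) \<in> s")
      case True
      then show ?thesis using x by blast
    next
      case False
      have r: "(a, a) \<in> s" using lin insert.prems by (auto simp: order_on_defs refl_on_def)
      have "(x, a) \<in> s"
        using False r lin insert.prems x(1) by (auto simp: order_on_defs total_on_def)
      then have "\<forall>y\<in>E. (y, a) \<in> s"
        using x(2) lin unfolding order_on_defs trans_def by blast
      then show ?thesis using r by blast
    qed
  qed
  ultimately obtain x where "x \<in> ?D" "\<forall>y\<in>?D. (y, x) \<in> s" using fin F by meson
  then show thesis using that by simp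
qed

lemma Well_order_omega_exp:
  assumes s: "Well_order s"
  shows "Well_order (omega_exp s)"
proof -
  have lin: "Linear_order s" and wf: "wf (s - Id)" using s by (auto simp: well_order_on_def)
  have tr: "trans s" and an: "antisym s" using lin by (auto simp: order_on_defs)
  define R where "R = (\<lambda>x y. (x, y) \<in> s - Id)"
  have asR: "asymp R" using an by (auto simp: R_def asymp_on_def antisym_def)
  have trR: "transp R"
    using trans_diff_Id[OF tr an] by (auto simp: R_def transp_on_def dest: transD)
  have "{(x, y). R x y} = s - Id" by (auto simp: R_def)
  with wf have wfR: "wfp R" by (simp add: wfp_def)
  define M :: "('a \<Rightarrow>\<^sub>0 nat) \<Rightarrow> 'a multiset" where "M f = Abs_multiset (coef f)" for f
  have cM: "count (M f) = coef f" for f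
    unfolding M_def by (rule count_Abs_multiset) simp
  have sub: "omega_exp s - Id \<subseteq> inv_image {(A, B). multp R A B} M"
  proof (rule subrelI)
    fix f g assume "(f, g) \<in> omega_exp s - Id"
    then obtain x where x: "coef f x < coef g x"
      "\<And>y. coef f y \<noteq> coef g y \<Longrightarrow> (y, x) \<in> s" by (auto simp: omega_exp_def)
    have "multp\<^sub>H\<^sub>O R (M f) (M g)"
      unfolding multp\<^sub>H\<^sub>O_def
    proof (intro conjI allI impI)
      show "M f \<noteq> M g" using x(1) cM by (metis less_irrefl)
      fix y assume y: "count (M g) y < count (M f) y"
      then have "R y x" using x unfolding R_def cM by force
      then show "\<exists>x. R y x \<and> count (M f) x < count (M g) x" using x cM by auto
    qed
    then show "(f, g) \<in> inv_image {(A, B). multp R A B} M"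
      using multp_eq_multp\<^sub>H\<^sub>O[OF asR trR] by simp
  qed
  have wfM: "wf (inv_image {(A, B). multp R A B} M)"
    using wfp_multp[OF wfR] by (intro wf_inv_image) (simp add: wfp_def)
  have trM: "trans (inv_image {(A, B). multp R A B} M)"
    using transp_multp[OF trR] by (intro trans_inv_image) (auto simp: trans_def transp_on_def)
  have wfo: "wf (omega_exp s - Id)" using wf_subset[OF wfM sub] .
  have rev: "(f, g) \<in> omega_exp s \<or> (g, f) \<in> omega_exp s"
    if fg: "Poly_Mapping.keys f \<subseteq> Field s" "Poly_Mapping.keys g \<subseteq> Field s" for f g
  proof (cases "f = g")
    case True
    then show ?thesis using that by (auto simp: omega_exp_def)
  next
    case False
    from omega_exp_max_diff[OF s fg False] obtain x where
      x: "coef f x \<noteq> coef g x" "\<And>y. coef f y \<noteq> coef g y \<Longrightarrow> (y, x) \<in> s" by metis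
    then have "coef f x < coef g x \<or> coef g x < coef f x" by auto
    then show ?thesis
    proof
      assume "coef f x < coef g x"
      then have "(f, g) \<in> omega_exp s" using x fg unfolding omega_exp_def by blast
      then show ?thesis ..
    next
      assume "coef g x < coef f x"
      moreover have "\<forall>y. coef g y \<noteq> coef f y \<longrightarrow> (y, x) \<in> s" using x(2) by (auto simp: eq_commute)
      ultimately have "(g, f) \<in> omega_exp s" using fg unfolding omega_exp_def by blast
      then show ?thesis ..
    qed
  qed
  have ano: "antisym (omega_exp s)"
  proof (rule antisymI, rule ccontr)
    fix f g assume "(f, g) \<in> omega_exp s" "(g, f) \<in> omega_exp s" "f \<noteq> g"
    then have "(f, g) \<in> omega_exp s - Id" "(g, f) \<in> omega_exp s - Id" by auto
    then show False using wfo by (blast dest: wf_not_sym)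
  qed
  have tro: "trans (omega_exp s)"
  proof (rule transI)
    fix f g h assume a: "(f, g) \<in> omega_exp s" "(g, h) \<in> omega_exp s"
    have k: "Poly_Mapping.keys f \<subseteq> Field s" "Poly_Mapping.keys h \<subseteq> Field s" using a by (auto simp: omega_exp_def)
    show "(f, h) \<in> omega_exp s"
    proof (rule ccontr)
      assume n: "(f, h) \<notin> omega_exp s"
      then have hf: "(h, f) \<in> omega_exp s" using rev k by blast
      have d: "f \<noteq> h" "f \<noteq> g" "g \<noteq> h" using n a hf ano k by (auto simp: omega_exp_def)
      have "(f, g) \<in> inv_image {(A, B). multp R A B} M"
        "(g, h) \<in> inv_image {(A, B). multp R A B} M"
        "(h, f) \<in> inv_image {(A, B). multp R A B} M"
        using a hf d by (auto intro!: subsetD[OF sub] simp del: in_inv_image)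
      then have "(f, f) \<in> inv_image {(A, B). multp R A B} M"
        by (meson transD[OF trM])
      from wf_not_refl[OF wfM] this show False by (rule notE)
    qed
  qed
  have "refl_on (Field (omega_exp s)) (omega_exp s)"
    unfolding refl_on_def Field_omega_exp by (simp add: omega_exp_def)
  moreover have "total_on (Field (omega_exp s)) (omega_exp s)"
    using rev unfolding Field_omega_exp total_on_def by blast
  moreover have "omega_exp s \<subseteq> Field (omega_exp s) \<times> Field (omega_exp s)"
    by (auto simp: Field_def)
  ultimately show ?thesis
    using wfo ano tro unfolding order_on_defs well_order_on_def by (intro conjI)
qed

text \<open>
  The Cantor normal form reading: if all exponents of \<open>f\<close> are at least \<open>x\<close>, then the interval from
  \<open>f\<close> (included) to \<open>f + \<omega>\<^sup>x\<close> (excluded) is order isomorphic to \<open>\<omega>\<^sup>x\<close>.  Hence the initial segment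
  below \<open>f\<close> has the order type \<open>\<omega>\<^sup>x \<cdot> c + \<omega>\<^sup>y \<cdot> d + \<dots>\<close>, where \<open>x > y > \<dots>\<close> are the
  exponents of \<open>f\<close> and \<open>c, d, \<dots>\<close> are their coefficients.
\<close>

lemma omega_exp_block:
  assumes s: "Well_order s" and x: "x \<in> Field s" and f: "Poly_Mapping.keys f \<subseteq> Field s"
    and fx: "\<And>y. y \<in> Poly_Mapping.keys f \<Longrightarrow> (x, y) \<in> s"
  defines "sx \<equiv> Restr s (underS s x)"
    and "f' \<equiv> f + Poly_Mapping.single x 1"
  shows "{h. (f, h) \<in> omega_exp s \<and> (h, f') \<in> omega_exp s \<and> h \<noteq> f'} = (+) f ` Field (omega_exp sx)"
    and "\<And>g h. g \<in> Field (omega_exp sx) \<Longrightarrow> h \<in> Field (omega_exp sx) \<Longrightarrow>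
           (f + g, f + h) \<in> omega_exp s \<longleftrightarrow> (g, h) \<in> omega_exp sx"
proof -
  have lin: "Linear_order s" using s by (simp add: well_order_on_def)
  then have tr: "trans s" and an: "antisym s" and re: "Refl s" and tt: "Total s"
    by (auto simp: order_on_defs)
  have refl: "(y, y) \<in> s" if "y \<in> Field s" for y using re that by (rule refl_onD)
  have tot: "(y, z) \<in> s \<or> (z, y) \<in> s" if "y \<in> Field s" "z \<in> Field s" for y z
    using tt refl that unfolding total_on_def by (cases "y = z") auto
  have U: "underS s x \<subseteq> Field s" by (auto simp: underS_def Field_def)
  have Fsx: "Field sx = underS s x"
    using U refl unfolding sx_def Field_def by blast
  have f0: "coef f y = 0" if "y \<in> underS s x" for y
    using that fx[of y] an by (auto simp: underS_def in_keys_iff antisym_def)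
  have f'x: "coef f' y = coef f y + (if y = x then 1 else 0)" for y
    by (simp add: f'_def lookup_add lookup_single)
  have f': "Poly_Mapping.keys f' \<subseteq> Field s"
    using f x f'x by (force simp: in_keys_iff subset_iff split: if_splits)
  have add: "Poly_Mapping.keys (f + g) \<subseteq> Field s" if "Poly_Mapping.keys g \<subseteq> underS s x" for g
    using f that U Poly_Mapping.keys_add[of f g] by blast
  show "(f + g, f + h) \<in> omega_exp s \<longleftrightarrow> (g, h) \<in> omega_exp sx"
    if "g \<in> Field (omega_exp sx)" "h \<in> Field (omega_exp sx)" for g h
  proof -
    have k: "Poly_Mapping.keys g \<subseteq> underS s x" "Poly_Mapping.keys h \<subseteq> underS s x"
      using that by (auto simp: Field_omega_exp Fsx)
    have "(y, z) \<in> s \<longleftrightarrow> (y, z) \<in> sx" if "coef g y \<noteq> coef h y" "coef g z < coef h z" for y z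
    proof -
      have "y \<in> Poly_Mapping.keys g \<union> Poly_Mapping.keys h" "z \<in> Poly_Mapping.keys h"
        using that by (auto simp: in_keys_iff)
      then have "y \<in> underS s x" "z \<in> underS s x" using k by auto
      then show ?thesis by (simp add: sx_def)
    qed
    then have "(\<exists>z. coef g z < coef h z \<and> (\<forall>y. coef g y \<noteq> coef h y \<longrightarrow> (y, z) \<in> s)) \<longleftrightarrow>
      (\<exists>z. coef g z < coef h z \<and> (\<forall>y. coef g y \<noteq> coef h y \<longrightarrow> (y, z) \<in> sx))"
      by blast
    then show ?thesis
      using k add[OF k(1)] add[OF k(2)] by (simp add: omega_exp_def lookup_add Fsx)
  qed
  show "{h. (f, h) \<in> omega_exp s \<and> (h, f') \<in> omega_exp s \<and> h \<noteq> f'} = (+) f ` Field (omega_exp sx)"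
  proof (intro equalityI subsetI)
    fix h assume "h \<in> (+) f ` Field (omega_exp sx)"
    then obtain g where g: "Poly_Mapping.keys g \<subseteq> underS s x" and h: "h = f + g"
      by (auto simp: Field_omega_exp Fsx)
    have gx: "(y, x) \<in> s \<and> y \<noteq> x" if "coef g y \<noteq> 0" for y
    proof -
      have "y \<in> Poly_Mapping.keys g" using that by (simp add: in_keys_iff)
      then have "y \<in> underS s x" using g by blast
      then show ?thesis by (simp add: underS_def)
    qed
    have "(f, h) \<in> omega_exp s"
    proof (cases "g = 0")
      case True
      then show ?thesis using f h by (simp add: omega_exp_def)
    next
      case False
      have "Poly_Mapping.keys g \<subseteq> Field s" using g U by blast
      with False obtain z where "coef 0 z \<noteq> coef g z" "\<And>y. coef 0 y \<noteq> coef g y \<Longrightarrow> (y, z) \<in> s"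
        using omega_exp_max_diff[OF s, of 0 g] by (metis empty_subsetI keys_zero)
      then have "coef f z < coef h z \<and> (\<forall>y. coef f y \<noteq> coef h y \<longrightarrow> (y, z) \<in> s)"
        by (simp add: h lookup_add)
      then show ?thesis using f add[OF g] h unfolding omega_exp_def by blast
    qed
    moreover have "coef h x < coef f' x" using gx[of x] by (auto simp: h lookup_add f'x)
    moreover have "\<forall>y. coef h y \<noteq> coef f' y \<longrightarrow> (y, x) \<in> s"
      using gx refl[OF x] by (auto simp: h lookup_add f'x split: if_splits)
    ultimately show "h \<in> {h. (f, h) \<in> omega_exp s \<and> (h, f') \<in> omega_exp s \<and> h \<noteq> f'}"
      using f' add[OF g] h unfolding omega_exp_def by auto
  next
    fix h assume "h \<in> {h. (f, h) \<in> omega_exp s \<and> (h, f') \<in> omega_exp s \<and> h \<noteq> f'}"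
    then have fh: "(f, h) \<in> omega_exp s" and hf': "(h, f') \<in> omega_exp s" "h \<noteq> f'" by auto
    from hf' obtain m where m: "coef h m < coef f' m"
      "\<And>y. coef h y \<noteq> coef f' y \<Longrightarrow> (y, m) \<in> s" and h: "Poly_Mapping.keys h \<subseteq> Field s"
      unfolding omega_exp_def by blast
    have "m \<in> Poly_Mapping.keys f'" using m(1) by (simp add: in_keys_iff)
    then have mF: "m \<in> Field s" using f' by blast
    have eq: "coef h y = coef f y" if y: "y \<notin> underS s x" for y
    proof (cases "f = h")
      case True
      then show ?thesis by simp
    next
      case False
      with fh obtain n where n: "coef f n < coef h n"
        "\<And>y. coef f y \<noteq> coef h y \<Longrightarrow> (y, n) \<in> s"
        unfolding omega_exp_def by blast
      show ?thesis
      proof (rule ccontr)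
        assume ne: "coef h y \<noteq> coef f y"
        then have "y \<in> Poly_Mapping.keys f \<union> Poly_Mapping.keys h" by (auto simp: in_keys_iff)
        then have yF: "y \<in> Field s" using f h by blast
        then have "(x, y) \<in> s" using y tot[OF x yF] refl[OF x] by (auto simp: underS_def)
        then have xn: "(x, n) \<in> s" using n(2)[of y] ne tr by (auto dest: transD)
        have xm: "(x, m) \<in> s"
        proof (rule ccontr)
          assume "(x, m) \<notin> s"
          then have "m \<in> underS s x" "m \<noteq> x" using tot[OF x mF] refl[OF x] by (auto simp: underS_def)
          then show False using m(1) f0 f'x by simp
        qed
        show False
        proof (cases "coef h m < coef f m")
          case True
          then have mn: "(m, n) \<in> s" using n(2) by auto
          have "m \<noteq> n" using True n(1) by auto
          then have "(n, m) \<notin> s" using antisymD[OF an mn] by blast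
          then have "coef h n = coef f' n" using m(2) by blast
          then have "n = x" using n(1) f'x[of n] by (simp split: if_splits)
          then show False using \<open>(n, m) \<notin> s\<close> xm by simp
        next
          case False
          then have mx: "m = x" "coef h m = coef f m" using m(1) f'x[of m] by (simp_all split: if_splits)
          then have "n \<noteq> x" using n(1) by auto
          then have "coef h n \<noteq> coef f' n" using n(1) f'x[of n] by simp
          then have "(n, x) \<in> s" using m(2) mx by simp
          then show False using antisymD[OF an _ xn] \<open>n \<noteq> x\<close> by blast
        qed
      qed
    qed
    have "f + (h - f) = h"
    proof (rule poly_mapping_eqI)
      fix y show "coef (f + (h - f)) y = coef h y"
        using eq[of y] f0[of y] by (cases "y \<in> underS s x") (auto simp: lookup_add lookup_minus)
    qed
    moreover have "Poly_Mapping.keys (h - f) \<subseteq> underS s x"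
    proof
      fix y assume "y \<in> Poly_Mapping.keys (h - f)"
      then have "coef h y \<noteq> coef f y" by (simp add: in_keys_iff lookup_minus)
      then show "y \<in> underS s x" using eq by blast
    qed
    ultimately show "h \<in> (+) f ` Field (omega_exp sx)"
      unfolding Field_omega_exp Fsx by (intro image_eqI[of h "(+) f" "h - f"]) simp_all
  qed
qed


section \<open>The natural numbers, integers and rationals of an ordinal\<close>

type_synonym 'a ord_nat = "('a \<Rightarrow>\<^sub>0 nat) \<Rightarrow>\<^sub>0 nat"
type_synonym 'a ord_int = "('a ord_nat \<times> 'a ord_nat) set"
type_synonym 'a ord_rat = "('a ord_int \<times> 'a ord_int) set"

text \<open>
  The ordinals below \<open>\<omega>\<^bsup>\<omega>\<^sup>\<alpha>\<^esup>\<close>, with exponents below \<open>\<omega>\<^sup>\<alpha>\<close>.  The Hessenberg sum is the pointwise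
  sum \<^term>\<open>(+)\<close> of Cantor normal forms; it applies to the exponents as well, and so the Hessenberg
  product is the convolution product \<^term>\<open>(*)\<close> of the type of finitely supported maps:
  \<open>\<omega>\<^sup>d \<cdot> \<omega>\<^sup>e = \<omega>\<^bsup>d + e\<^esup>\<close> on monomials, extended bilinearly.
\<close>

definition ord_nats :: "'a rel \<Rightarrow> 'a ord_nat set" where
  "ord_nats \<alpha> = Field (omega_exp (omega_exp \<alpha>))"

definition nat_le :: "'a rel \<Rightarrow> 'a ord_nat \<Rightarrow> 'a ord_nat \<Rightarrow> bool" where
  "nat_le \<alpha> a b \<longleftrightarrow> (a, b) \<in> omega_exp (omega_exp \<alpha>)"

definition int_rel :: "'a rel \<Rightarrow> ('a ord_nat \<times> 'a ord_nat) rel" where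
  "int_rel \<alpha> = {((a, b), (c, d)). a \<in> ord_nats \<alpha> \<and> b \<in> ord_nats \<alpha> \<and>
     c \<in> ord_nats \<alpha> \<and> d \<in> ord_nats \<alpha> \<and> a + d = b + c}"

definition ord_ints :: "'a rel \<Rightarrow> 'a ord_int set" where
  "ord_ints \<alpha> = (ord_nats \<alpha> \<times> ord_nats \<alpha>) // int_rel \<alpha>"

definition int_zero :: "'a rel \<Rightarrow> 'a ord_int" where
  "int_zero \<alpha> = int_rel \<alpha> `` {(0, 0)}"

definition int_add :: "'a rel \<Rightarrow> 'a ord_int \<Rightarrow> 'a ord_int \<Rightarrow> 'a ord_int" where
  "int_add \<alpha> X Y = (\<Union>(a, b)\<in>X. \<Union>(c, d)\<in>Y. int_rel \<alpha> `` {(a + c, b + d)})"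

definition int_neg :: "'a rel \<Rightarrow> 'a ord_int \<Rightarrow> 'a ord_int" where
  "int_neg \<alpha> X = (\<Union>(a, b)\<in>X. int_rel \<alpha> `` {(b, a)})"

definition int_mult :: "'a rel \<Rightarrow> 'a ord_int \<Rightarrow> 'a ord_int \<Rightarrow> 'a ord_int" where
  "int_mult \<alpha> X Y = (\<Union>(a, b)\<in>X. \<Union>(c, d)\<in>Y. int_rel \<alpha> `` {(a * c + b * d, a * d + b * c)})"

definition int_le :: "'a rel \<Rightarrow> 'a ord_int \<Rightarrow> 'a ord_int \<Rightarrow> bool" where
  "int_le \<alpha> Y X \<longleftrightarrow>
     (\<exists>a\<^sub>1 a\<^sub>2 b\<^sub>1 b\<^sub>2. (a\<^sub>1, a\<^sub>2) \<in> X \<and> (b\<^sub>1, b\<^sub>2) \<in> Y \<and> nat_le \<alpha> (a\<^sub>2 + b\<^sub>1) (a\<^sub>1 + b\<^sub>2))"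

definition rat_rel :: "'a rel \<Rightarrow> ('a ord_int \<times> 'a ord_int) rel" where
  "rat_rel \<alpha> = {((a, b), (c, d)). a \<in> ord_ints \<alpha> \<and> b \<in> ord_ints \<alpha> - {int_zero \<alpha>} \<and>
     c \<in> ord_ints \<alpha> \<and> d \<in> ord_ints \<alpha> - {int_zero \<alpha>} \<and> int_mult \<alpha> a d = int_mult \<alpha> b c}"

definition ord_rats :: "'a rel \<Rightarrow> 'a ord_rat set" where
  "ord_rats \<alpha> = (ord_ints \<alpha> \<times> (ord_ints \<alpha> - {int_zero \<alpha>})) // rat_rel \<alpha>"

definition rat_add :: "'a rel \<Rightarrow> 'a ord_rat \<Rightarrow> 'a ord_rat \<Rightarrow> 'a ord_rat" where
  "rat_add \<alpha> X Y = (\<Union>(a, b)\<in>X. \<Union>(c, d)\<in>Y.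
     rat_rel \<alpha> `` {(int_add \<alpha> (int_mult \<alpha> a d) (int_mult \<alpha> b c), int_mult \<alpha> b d)})"

definition rat_neg :: "'a rel \<Rightarrow> 'a ord_rat \<Rightarrow> 'a ord_rat" where
  "rat_neg \<alpha> X = (\<Union>(a, b)\<in>X. rat_rel \<alpha> `` {(int_neg \<alpha> a, b)})"

definition rat_mult :: "'a rel \<Rightarrow> 'a ord_rat \<Rightarrow> 'a ord_rat \<Rightarrow> 'a ord_rat" where
  "rat_mult \<alpha> X Y = (\<Union>(a, b)\<in>X. \<Union>(c, d)\<in>Y. rat_rel \<alpha> `` {(int_mult \<alpha> a c, int_mult \<alpha> b d)})"

definition rat_nonneg :: "'a rel \<Rightarrow> 'a ord_rat \<Rightarrow> bool" where
  "rat_nonneg \<alpha> X \<longleftrightarrow> (\<exists>a b. (a, b) \<in> X \<and> int_le \<alpha> (int_zero \<alpha>) (int_mult \<alpha> a b))"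

definition rat_order :: "'a rel \<Rightarrow> 'a ord_rat gorder" where
  "rat_order \<alpha> = \<lparr>carrier = ord_rats \<alpha>, eq = (=),
     le = (\<lambda>B A. rat_nonneg \<alpha> (rat_add \<alpha> A (rat_neg \<alpha> B)))\<rparr>"


section \<open>Dedekind cuts\<close>

text \<open>
  The condition \<open>inf B \<notin> B\<close> is meant to hold also if \<open>B\<close> has no infimum, and likewise for
  \<open>sup A \<notin> A\<close>.  Either part of a cut may be empty.  That \<open>A\<close> is an initial and \<open>B\<close> a final
  segment has to be demanded: the other conditions allow the at most one point outside \<open>A \<union> B\<close> to
  lie amid \<open>A\<close> or amid \<open>B\<close>, as in \<open>A = {x. x < \<surd>2} - {0}\<close> and \<open>B = {x. x > \<surd>2}\<close> on the
  rational numbers, and with such pairs bounded sets need not have an infimum.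
\<close>

definition dedekind_cut :: "'q gorder \<Rightarrow> 'q set \<Rightarrow> 'q set \<Rightarrow> bool" where
  "dedekind_cut Q A B \<longleftrightarrow>
     A \<subseteq> carrier Q \<and> B \<subseteq> carrier Q \<and>
     (\<forall>a\<in>A. \<forall>b\<in>B. a \<sqsubset>\<^bsub>Q\<^esub> b) \<and>
     (\<forall>x\<in>carrier Q - (A \<union> B). \<forall>y\<in>carrier Q - (A \<union> B). x = y) \<and>
     (\<forall>m. greatest Q m (Lower Q B) \<longrightarrow> m \<notin> B) \<and>
     (\<forall>m. least Q m (Upper Q A) \<longrightarrow> m \<notin> A) \<and>
     A \<inter> B = {} \<and>
     (\<forall>a\<in>A. \<forall>x\<in>carrier Q. x \<sqsubseteq>\<^bsub>Q\<^esub> a \<longrightarrow> x \<in> A) \<and>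
     (\<forall>b\<in>B. \<forall>x\<in>carrier Q. b \<sqsubseteq>\<^bsub>Q\<^esub> x \<longrightarrow> x \<in> B)"

definition cut_order :: "'q gorder \<Rightarrow> ('q set \<times> 'q set) gorder" where
  "cut_order Q = \<lparr>carrier = {(A, B). dedekind_cut Q A B}, eq = (=),
     le = (\<lambda>(A\<^sub>2, B\<^sub>2) (A\<^sub>1, B\<^sub>1). A\<^sub>2 \<subseteq> A\<^sub>1)\<rparr>"

definition ord_reals :: "'a rel \<Rightarrow> ('a ord_rat set \<times> 'a ord_rat set) gorder" where
  "ord_reals \<alpha> = cut_order (rat_order \<alpha>)"

end

theory Submission
  imports Defs
begin

text \<open>
  The ordered set \<open>\<rat>\<^sub>\<alpha>\<close> is a dense linear order: the integers \<open>\<int>\<^sub>\<alpha>\<close> embed into the monoid ring over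
  \<open>\<int>\<close> of the exponents below \<open>\<omega>\<^sup>\<alpha>\<close>, where an element is positive iff its leading coefficient is;
  leading coefficients multiply, so \<open>\<int>\<^sub>\<alpha>\<close> is an ordered domain and \<open>\<rat>\<^sub>\<alpha>\<close> has midpoints.  The union of
  the lower parts of a set of cuts has no maximum, and by density it is the lower part of a cut;
  this gives the suprema, and an infimum is the supremum of the lower bounds.
\<close>

section \<open>Cuts of a dense linear order\<close>

lemma dedekind_cut_lower:
  assumes "dedekind_cut Q A B"
  shows "A \<subseteq> carrier Q"
    and "a \<in> A \<Longrightarrow> x \<in> carrier Q \<Longrightarrow> x \<sqsubseteq>\<^bsub>Q\<^esub> a \<Longrightarrow> x \<in> A"
    and "least Q m (Upper Q A) \<Longrightarrow> m \<notin> A"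
  using assms by (simp_all only: dedekind_cut_def) blast

text \<open>Initial segments without a maximum are stable under unions, which takes care of the
  lower part. The upper part is forced: everything above the union, except a possible minimum, which
  becomes the one point that a cut may omit. Density ensures that removing this minimum does not
  create a new one.\<close>

lemma Union_lower_parts_cut:
  assumes eq: "eq Q = (=)"
    and total: "\<And>x y. x \<in> carrier Q \<Longrightarrow> y \<in> carrier Q \<Longrightarrow> x \<sqsubseteq>\<^bsub>Q\<^esub> y \<or> y \<sqsubseteq>\<^bsub>Q\<^esub> x"
    and antisym: "\<And>x y. x \<in> carrier Q \<Longrightarrow> y \<in> carrier Q \<Longrightarrow> x \<sqsubseteq>\<^bsub>Q\<^esub> y \<Longrightarrow> y \<sqsubseteq>\<^bsub>Q\<^esub> x \<Longrightarrow> x = y"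
    and trans: "\<And>x y z. x \<in> carrier Q \<Longrightarrow> y \<in> carrier Q \<Longrightarrow> z \<in> carrier Q \<Longrightarrow>
      x \<sqsubseteq>\<^bsub>Q\<^esub> y \<Longrightarrow> y \<sqsubseteq>\<^bsub>Q\<^esub> z \<Longrightarrow> x \<sqsubseteq>\<^bsub>Q\<^esub> z"
    and dense: "\<And>x y. x \<in> carrier Q \<Longrightarrow> y \<in> carrier Q \<Longrightarrow> x \<sqsubseteq>\<^bsub>Q\<^esub> y \<Longrightarrow> x \<noteq> y \<Longrightarrow>
      \<exists>z\<in>carrier Q. x \<sqsubseteq>\<^bsub>Q\<^esub> z \<and> z \<sqsubseteq>\<^bsub>Q\<^esub> y \<and> z \<noteq> x \<and> z \<noteq> y"
    and cuts: "\<And>A B. (A, B) \<in> S \<Longrightarrow> dedekind_cut Q A B"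
  shows "\<exists>B. dedekind_cut Q (\<Union>(fst ` S)) B"
proof -
  define A where "A = \<Union>(fst ` S)"
  define C where "C = carrier Q - A"
  \<comment> \<open>The removed set is the set of minima of \<open>C\<close>; by antisymmetry it has
    at most one element.\<close>
  define B where "B = C - {p \<in> C. \<forall>c\<in>C. p \<sqsubseteq>\<^bsub>Q\<^esub> c}"
  have A_carrier: "A \<subseteq> carrier Q"
  proof
    fix x assume "x \<in> A"
    then obtain A' B' where p: "(A', B') \<in> S" "x \<in> A'" by (auto simp: A_def)
    then show "x \<in> carrier Q" using dedekind_cut_lower(1)[OF cuts] by blast
  qed
  have A_down: "x \<in> A" if ax: "a \<in> A" "x \<in> carrier Q" "x \<sqsubseteq>\<^bsub>Q\<^esub> a" for a x
  proof -
    obtain A' B' where p: "(A', B') \<in> S" "a \<in> A'" using ax(1) by (auto simp: A_def)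
    then have "x \<in> A'" using dedekind_cut_lower(2)[OF cuts[OF p(1)]] ax(2,3) by blast
    then show ?thesis using p(1) unfolding A_def by force
  qed
  have refl: "x \<sqsubseteq>\<^bsub>Q\<^esub> x" if "x \<in> carrier Q" for x using total[OF that that] by simp
  have A_below_C: "a \<sqsubseteq>\<^bsub>Q\<^esub> c" if "a \<in> A" "c \<in> C" for a c
    using that total[of a c] A_down[of a c] A_carrier unfolding C_def by blast
  have C_up: "x \<in> C" if "c \<in> C" "x \<in> carrier Q" "c \<sqsubseteq>\<^bsub>Q\<^esub> x" for c x
    using that A_down[of x c] unfolding C_def by blast
  \<comment> \<open>A least upper bound of \<open>A\<close> inside \<open>A\<close> would be a
    maximum. It would lie in one of the united lower parts and be a maximum there as well, against
    the cut condition for that part.\<close>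
  have no_max: "m \<notin> A" if m: "least Q m (Upper Q A)" for m
  proof
    assume "m \<in> A"
    then obtain A' B' where p: "(A', B') \<in> S" "m \<in> A'" by (auto simp: A_def)
    have sub: "A' \<subseteq> A" using p(1) by (force simp: A_def)
    have "m \<in> Upper Q A'" using m Upper_antimono[OF sub] by (auto simp: least_def)
    moreover have "m \<sqsubseteq>\<^bsub>Q\<^esub> u" if "u \<in> Upper Q A'" for u
      using that p(2) sub A_carrier by (auto simp: Upper_def)
    ultimately have "least Q m (Upper Q A')" by (simp add: least_def Upper_closed)
    then show False using dedekind_cut_lower(3)[OF cuts[OF p(1)]] p(2) by blast
  qed
  have no_min: "m \<notin> B" if m: "greatest Q m (Lower Q B)" for m
  proof
    assume mB: "m \<in> B"
    have BQ: "B \<subseteq> carrier Q" by (auto simp: B_def C_def)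
    have m_le: "m \<sqsubseteq>\<^bsub>Q\<^esub> b" if "b \<in> B" for b using m that BQ by (auto simp: greatest_def Lower_def)
    have mC: "m \<in> C" "m \<in> carrier Q" using mB BQ by (auto simp: B_def)
    \<comment> \<open>Being in \<open>B\<close>, \<open>m\<close> is not a minimum of
      \<open>C\<close>. The witness \<open>c\<close> cannot be in \<open>B\<close>, where
      \<open>m\<close> is smallest, so \<open>c\<close> is the removed minimum. A point strictly
      between \<open>c\<close> and \<open>m\<close> then lies in \<open>B\<close> below
      \<open>m\<close>.\<close>
    from mB mC obtain c where c: "c \<in> C" "\<not> m \<sqsubseteq>\<^bsub>Q\<^esub> c" by (auto simp: B_def)
    then have "c \<notin> B" using m_le by blast
    then have cmin: "\<And>d. d \<in> C \<Longrightarrow> c \<sqsubseteq>\<^bsub>Q\<^esub> d" using c(1) by (auto simp: B_def)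
    have cQ: "c \<in> carrier Q" using c by (simp add: C_def)
    have "c \<sqsubseteq>\<^bsub>Q\<^esub> m" "c \<noteq> m" using cmin mC c refl by auto
    then obtain z where z: "z \<in> carrier Q" "c \<sqsubseteq>\<^bsub>Q\<^esub> z" "z \<sqsubseteq>\<^bsub>Q\<^esub> m" "z \<noteq> c" "z \<noteq> m"
      using dense[OF cQ mC(2)] by blast
    have "z \<in> C" using C_up[OF c(1) z(1,2)] .
    moreover have "\<not> z \<sqsubseteq>\<^bsub>Q\<^esub> c" using antisym[OF z(1) cQ] z by blast
    ultimately have "z \<in> B" using c by (auto simp: B_def)
    then show False using m_le antisym z mC by blast
  qed
  have "dedekind_cut Q A B"
    unfolding dedekind_cut_def
  proof (intro conjI)
    show "A \<subseteq> carrier Q" by fact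
    show "B \<subseteq> carrier Q" "A \<inter> B = {}" by (auto simp: B_def C_def)
    show "\<forall>a\<in>A. \<forall>b\<in>B. a \<sqsubset>\<^bsub>Q\<^esub> b"
      using A_below_C by (auto simp: lless_def eq B_def C_def)
    have "carrier Q - (A \<union> B) = {p \<in> C. \<forall>c\<in>C. p \<sqsubseteq>\<^bsub>Q\<^esub> c}" by (auto simp: B_def C_def)
    then show "\<forall>x\<in>carrier Q - (A \<union> B). \<forall>y\<in>carrier Q - (A \<union> B). x = y"
      using antisym by (simp add: C_def)
    show "\<forall>m. greatest Q m (Lower Q B) \<longrightarrow> m \<notin> B" using no_min by blast
    show "\<forall>m. least Q m (Upper Q A) \<longrightarrow> m \<notin> A" using no_max by blast
    show "\<forall>a\<in>A. \<forall>x\<in>carrier Q. x \<sqsubseteq>\<^bsub>Q\<^esub> a \<longrightarrow> x \<in> A" using A_down by blast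
    show "\<forall>b\<in>B. \<forall>x\<in>carrier Q. b \<sqsubseteq>\<^bsub>Q\<^esub> x \<longrightarrow> x \<in> B"
    proof (intro ballI impI)
      fix b x assume b: "b \<in> B" and x: "x \<in> carrier Q" "b \<sqsubseteq>\<^bsub>Q\<^esub> x"
      then have bC: "b \<in> C" "b \<in> carrier Q" by (auto simp: B_def C_def)
      \<comment> \<open>Since \<open>b\<close> is not a minimum of \<open>C\<close>, some
        \<open>c\<close> in \<open>C\<close> is not above \<open>b\<close>; by transitivity it is
        not above the larger \<open>x\<close> either, so \<open>x\<close> is not removed.\<close>
      from b obtain c where c: "c \<in> C" "\<not> b \<sqsubseteq>\<^bsub>Q\<^esub> c" by (auto simp: B_def)
      have "\<not> x \<sqsubseteq>\<^bsub>Q\<^esub> c" using trans[OF bC(2) x(1) _ x(2)] c by (auto simp: C_def)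
      then show "x \<in> B" using C_up[OF bC(1) x] c(1) by (auto simp: B_def)
    qed
  qed
  then show ?thesis unfolding A_def by blast
qed

text \<open>The order looks at lower parts only and is inclusion there, so a cut whose lower part is
  a union is a supremum. The first hypothesis concerns arbitrary sets of cuts because the infimum
  applies it to the set of lower bounds.\<close>

lemma cut_order_complete:
  assumes union: "\<And>T. T \<subseteq> carrier (cut_order Q) \<Longrightarrow> \<exists>B. dedekind_cut Q (\<Union>(fst ` T)) B"
    and S: "S \<subseteq> carrier (cut_order Q)"
  shows "\<exists>s\<in>carrier (cut_order Q). least (cut_order Q) s (Upper (cut_order Q) S)"
    and "\<exists>i\<in>carrier (cut_order Q). greatest (cut_order Q) i (Lower (cut_order Q) S)"
proof -
  have le: "x \<sqsubseteq>\<^bsub>cut_order Q\<^esub> y \<longleftrightarrow> fst x \<subseteq> fst y" for x y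
    by (simp add: cut_order_def split_beta)
  have sup: "\<exists>s\<in>carrier (cut_order Q). fst s = \<Union>(fst ` T)" if T: "T \<subseteq> carrier (cut_order Q)" for T
  proof -
    from union[OF T] obtain B where "dedekind_cut Q (\<Union>(fst ` T)) B" ..
    then have "(\<Union>(fst ` T), B) \<in> carrier (cut_order Q)" by (simp add: cut_order_def)
    then show ?thesis by (intro bexI) simp_all
  qed
  obtain s where s: "s \<in> carrier (cut_order Q)" "fst s = \<Union>(fst ` S)" using sup[OF S] by blast
  have "s \<in> Upper (cut_order Q) S"
  proof (rule Upper_memI)
    fix x assume "x \<in> S"
    then have "fst x \<subseteq> \<Union>(fst ` S)" by (rule UN_upper)
    then show "x \<sqsubseteq>\<^bsub>cut_order Q\<^esub> s" by (simp only: le s(2))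
  qed (rule s(1))
  moreover have "s \<sqsubseteq>\<^bsub>cut_order Q\<^esub> u" if "u \<in> Upper (cut_order Q) S" for u
    unfolding le s(2)
  proof (rule UN_least)
    fix x assume "x \<in> S"
    then have "x \<sqsubseteq>\<^bsub>cut_order Q\<^esub> u" using Upper_memD[OF that _ S] by blast
    then show "fst x \<subseteq> fst u" by (simp only: le)
  qed
  ultimately have "least (cut_order Q) s (Upper (cut_order Q) S)"
    by (simp add: least_def Upper_closed)
  then show "\<exists>s\<in>carrier (cut_order Q). least (cut_order Q) s (Upper (cut_order Q) S)"
    using s(1) by (rule bexI)
  obtain i where i: "i \<in> carrier (cut_order Q)" "fst i = \<Union>(fst ` Lower (cut_order Q) S)"
    using sup[OF Lower_closed] by blast
  have "i \<in> Lower (cut_order Q) S"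
  proof (rule Lower_memI)
    fix x assume x: "x \<in> S"
    show "i \<sqsubseteq>\<^bsub>cut_order Q\<^esub> x"
      unfolding le i(2)
    proof (rule UN_least)
      fix l assume "l \<in> Lower (cut_order Q) S"
      then have "l \<sqsubseteq>\<^bsub>cut_order Q\<^esub> x" using Lower_memD[OF _ x S] by blast
      then show "fst l \<subseteq> fst x" by (simp only: le)
    qed
  qed (rule i(1))
  moreover have "l \<sqsubseteq>\<^bsub>cut_order Q\<^esub> i" if "l \<in> Lower (cut_order Q) S" for l
    unfolding le i(2) using that by (rule UN_upper)
  ultimately have "greatest (cut_order Q) i (Lower (cut_order Q) S)"
    by (simp add: greatest_def Lower_closed)
  then show "\<exists>i\<in>carrier (cut_order Q). greatest (cut_order Q) i (Lower (cut_order Q) S)"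
    using i(1) by (rule bexI)
qed


section \<open>Fractions over a positive cone\<close>

text \<open>An ordered integral domain given by its positive elements, as a subset \<open>D\<close>
  of a ring type. The ambient monoid ring also has exponents outside the well-order, so only a
  subring of it is ordered.\<close>

locale positive_cone =
  fixes D :: "'r::comm_ring_1 set" and pos :: "'r \<Rightarrow> bool"
  assumes add_closed: "x \<in> D \<Longrightarrow> y \<in> D \<Longrightarrow> x + y \<in> D"
    and mult_closed: "x \<in> D \<Longrightarrow> y \<in> D \<Longrightarrow> x * y \<in> D"
    and uminus_closed: "x \<in> D \<Longrightarrow> - x \<in> D"
    and pos_add: "x \<in> D \<Longrightarrow> y \<in> D \<Longrightarrow> pos x \<Longrightarrow> pos y \<Longrightarrow> pos (x + y)"
    and pos_mult: "x \<in> D \<Longrightarrow> y \<in> D \<Longrightarrow> pos x \<Longrightarrow> pos y \<Longrightarrow> pos (x * y)"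
    and pos_cases: "x \<in> D \<Longrightarrow> x = 0 \<or> pos x \<or> pos (- x)"
    and not_pos_zero: "\<not> pos 0"
begin

lemma diff_closed: "x \<in> D \<Longrightarrow> y \<in> D \<Longrightarrow> x - y \<in> D"
  using add_closed[of x "- y"] uminus_closed by simp

definition nonneg :: "'r \<Rightarrow> bool" where
  "nonneg x \<longleftrightarrow> x = 0 \<or> pos x"

lemma nonneg_total: "x \<in> D \<Longrightarrow> nonneg x \<or> nonneg (- x)"
  using pos_cases by (auto simp: nonneg_def)

lemma nonneg_antisym: "x \<in> D \<Longrightarrow> nonneg x \<Longrightarrow> nonneg (- x) \<Longrightarrow> x = 0"
  using pos_add[of x "- x"] uminus_closed[of x] not_pos_zero by (auto simp: nonneg_def)

lemma nonneg_add: "x \<in> D \<Longrightarrow> y \<in> D \<Longrightarrow> nonneg x \<Longrightarrow> nonneg y \<Longrightarrow> nonneg (x + y)"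
  using pos_add by (auto simp: nonneg_def)

lemma nonneg_mult: "x \<in> D \<Longrightarrow> y \<in> D \<Longrightarrow> nonneg x \<Longrightarrow> nonneg y \<Longrightarrow> nonneg (x * y)"
  using pos_mult by (auto simp: nonneg_def)

text \<open>If both factors are nonzero, changing signs makes both positive, so the product is
  positive up to sign and cannot be zero.\<close>

lemma mult_eq_zero:
  assumes "x \<in> D" "y \<in> D" "x * y = 0"
  shows "x = 0 \<or> y = 0"
proof (rule ccontr)
  assume "\<not> ?thesis"
  then have "pos x \<or> pos (- x)" "pos y \<or> pos (- y)" using pos_cases assms by auto
  then have "pos (x * y) \<or> pos (- (x * y))"
    using pos_mult[of x y] pos_mult[of "- x" y] pos_mult[of x "- y"] pos_mult[of "- x" "- y"]
      uminus_closed assms(1,2) by auto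
  then show False using assms(3) not_pos_zero by simp
qed

lemma nonneg_square: "x \<in> D \<Longrightarrow> nonneg (x * x)"
  using nonneg_total[of x] nonneg_mult[of x x] nonneg_mult[of "- x" "- x"] uminus_closed[of x]
  by auto

text \<open>Allows denominators of unknown sign to be cleared. Otherwise \<open>- x\<close> would be
  nonnegative, so \<open>s * s * x\<close> would be nonnegative along with its negative, hence zero,
  which forces \<open>x = 0\<close>.\<close>

lemma nonneg_square_cancel:
  assumes "s \<in> D" "x \<in> D" "s \<noteq> 0" "nonneg (s * s * x)"
  shows "nonneg x"
proof (rule ccontr)
  assume n: "\<not> nonneg x"
  then have "nonneg (- x)" using nonneg_total assms(2) by blast
  then have "nonneg (s * s * - x)"
    using assms by (intro nonneg_mult nonneg_square mult_closed uminus_closed)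
  then have "s * s * x = 0"
    using assms by (intro nonneg_antisym mult_closed) simp_all
  then have "x = 0" using mult_eq_zero mult_closed assms by metis
  then show False using n by (simp add: nonneg_def)
qed

text \<open>The pair \<open>(p, q)\<close> stands for the fraction \<open>p / q\<close>, whose denominator may be negative.\<close>

definition fractions :: "('r \<times> 'r) set" where
  "fractions = D \<times> (D - {0})"

text \<open>The tested element is r/s - p/q multiplied by the square of q s, so the signs of the
  denominators need no case distinction.\<close>

fun frac_le :: "'r \<times> 'r \<Rightarrow> 'r \<times> 'r \<Rightarrow> bool" where
  "frac_le (p, q) (r, s) \<longleftrightarrow> nonneg ((r * q - p * s) * (q * s))"

lemma frac_le_total: "x \<in> fractions \<Longrightarrow> y \<in> fractions \<Longrightarrow> frac_le x y \<or> frac_le y x"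
proof -
  assume "x \<in> fractions" "y \<in> fractions"
  then obtain p q r s where xy: "x = (p, q)" "y = (r, s)" "p \<in> D" "q \<in> D" "r \<in> D" "s \<in> D"
    by (auto simp: fractions_def)
  have e: "(p * s - r * q) * (s * q) = - ((r * q - p * s) * (q * s))" by (simp add: algebra_simps)
  show ?thesis
    using xy nonneg_total[of "(r * q - p * s) * (q * s)"]
    by (simp only: frac_le.simps e) (simp add: mult_closed diff_closed)
qed

lemma frac_le_antisym:
  assumes x: "(p, q) \<in> fractions" "(r, s) \<in> fractions"
    and le: "frac_le (p, q) (r, s)" "frac_le (r, s) (p, q)"
  shows "p * s = q * r"
proof -
  have D: "p \<in> D" "q \<in> D" "r \<in> D" "s \<in> D" "q \<noteq> 0" "s \<noteq> 0" using x by (auto simp: fractions_def)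
  have e: "(p * s - r * q) * (s * q) = - ((r * q - p * s) * (q * s))" by (simp add: algebra_simps)
  have "(r * q - p * s) * (q * s) = 0"
    using le D unfolding frac_le.simps e by (intro nonneg_antisym mult_closed diff_closed)
  then have "r * q - p * s = 0"
    using mult_eq_zero D mult_closed diff_closed by metis
  then show ?thesis by (simp add: algebra_simps)
qed

lemma frac_le_trans:
  assumes xyz: "x \<in> fractions" "y \<in> fractions" "z \<in> fractions"
    and le: "frac_le x y" "frac_le y z"
  shows "frac_le x z"
proof -
  obtain p q r s t u where e: "x = (p, q)" "y = (r, s)" "z = (t, u)"
    by (cases x, cases y, cases z)
  then have D: "p \<in> D" "q \<in> D" "r \<in> D" "s \<in> D" "t \<in> D" "u \<in> D" "s \<noteq> 0"
    using xyz by (auto simp: fractions_def)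
  \<comment> \<open>The differences r/s - p/q and t/u - r/s, multiplied by the square of q s u.
    Their sum is t/u - p/q with the same factor, from which the square of \<open>s\<close> is
    cancelled.\<close>
  have "nonneg (u * u * ((r * q - p * s) * (q * s)))" "nonneg (q * q * ((t * s - r * u) * (s * u)))"
    using le D unfolding e by (auto intro!: nonneg_mult nonneg_square mult_closed diff_closed)
  then have "nonneg (u * u * ((r * q - p * s) * (q * s)) + q * q * ((t * s - r * u) * (s * u)))"
    using D by (intro nonneg_add mult_closed diff_closed)
  also have "u * u * ((r * q - p * s) * (q * s)) + q * q * ((t * s - r * u) * (s * u)) =
      s * s * ((t * q - p * u) * (q * u))"
    by (simp add: algebra_simps)
  finally have "nonneg ((t * q - p * u) * (q * u))"
    using D nonneg_square_cancel[of s "(t * q - p * u) * (q * u)"] by (simp add: mult_closed diff_closed)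
  then show ?thesis by (simp add: e)
qed

text \<open>The order excludes 2-torsion, so that the denominator of a midpoint is nonzero.\<close>

lemma double_nonzero: "x \<in> D \<Longrightarrow> x \<noteq> 0 \<Longrightarrow> x + x \<noteq> 0"
  using pos_cases[of x] pos_add[of x x] pos_add[of "- x" "- x"] uminus_closed[of x] not_pos_zero
  by (metis add.inverse_neutral minus_add_distrib)

text \<open>The distance from m/d to either end is half of r/s - p/q, hence has the same sign.
  Strictness is phrased by cross-multiplication, the form that equality of fraction classes
  takes.\<close>

lemma frac_midpoint:
  assumes "(p, q) \<in> fractions" "(r, s) \<in> fractions" "frac_le (p, q) (r, s)" "p * s \<noteq> q * r"
  defines "m \<equiv> p * s + q * r" and "d \<equiv> q * s + q * s"
  shows "(m, d) \<in> fractions" "frac_le (p, q) (m, d)" "frac_le (m, d) (r, s)"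
    "m * q \<noteq> d * p" "m * s \<noteq> d * r"
proof -
  have D: "p \<in> D" "q \<in> D" "r \<in> D" "s \<in> D" "q \<noteq> 0" "s \<noteq> 0" using assms by (auto simp: fractions_def)
  have qs: "q * s \<noteq> 0" using mult_eq_zero D by blast
  then have "d \<noteq> 0" unfolding d_def using double_nonzero mult_closed D by blast
  moreover have "m \<in> D" "d \<in> D" using D unfolding m_def d_def by (safe intro!: add_closed mult_closed)
  ultimately show "(m, d) \<in> fractions" by (simp add: fractions_def)
  let ?n = "(r * q - p * s) * (q * s)"
  have n: "nonneg ?n" "?n \<in> D" using assms(3) D by (auto intro!: mult_closed diff_closed)
  then have nn: "nonneg (?n + ?n)" "?n + ?n \<in> D" by (safe intro!: nonneg_add add_closed)
  have "nonneg (q * q * (?n + ?n))" "nonneg (s * s * (?n + ?n))"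
    using nn D by (auto intro!: nonneg_mult nonneg_square mult_closed)
  moreover have "q * q * (?n + ?n) = (m * q - p * d) * (q * d)"
    "s * s * (?n + ?n) = (r * d - m * s) * (d * s)"
    by (simp_all add: m_def d_def algebra_simps)
  ultimately show "frac_le (p, q) (m, d)" "frac_le (m, d) (r, s)" by simp_all
  have ne: "r * q - p * s \<noteq> 0" using assms(4) by (simp add: algebra_simps)
  have "q * (r * q - p * s) \<noteq> 0" "s * (r * q - p * s) \<noteq> 0"
    using mult_eq_zero[of _ "r * q - p * s"] D ne by (auto simp: mult_closed diff_closed)
  moreover have "m * q - d * p = q * (r * q - p * s)" "d * r - m * s = s * (r * q - p * s)"
    by (simp_all add: m_def d_def algebra_simps)
  ultimately show "m * q \<noteq> d * p" "m * s \<noteq> d * r" by auto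
qed

end


section \<open>The leading coefficient in the monoid ring\<close>

text \<open>Replaces the sums over all exponents in the convolution by finite sums over the
  supports, where the usual rules for \<open>sum\<close> apply.\<close>

lemma lookup_mult_keys:
  fixes f g :: "'a::monoid_add \<Rightarrow>\<^sub>0 'b::semiring_0"
  shows "coef (f * g) k =
    (\<Sum>l\<in>Poly_Mapping.keys f. \<Sum>q\<in>Poly_Mapping.keys g. if k = l + q then coef f l * coef g q else 0)"
proof -
  have inner: "(\<Sum>q. coef g q when k = l + q) =
    (\<Sum>q\<in>Poly_Mapping.keys g. if k = l + q then coef g q else 0)" for l
    by (subst Sum_any.expand_superset[of "Poly_Mapping.keys g"])
      (auto simp: in_keys_iff when_def intro!: sum.cong)
  have "coef (f * g) k = (\<Sum>l\<in>Poly_Mapping.keys f. coef f l *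
    (\<Sum>q\<in>Poly_Mapping.keys g. if k = l + q then coef g q else 0))"
    unfolding lookup_mult inner
    by (rule Sum_any.expand_superset) (auto simp: in_keys_iff)
  then show ?thesis by (simp add: sum_distrib_left if_distrib cong: if_cong)
qed

text \<open>On an \<open>'a ord_nat\<close> this makes the outer coefficients integers and leaves
  the exponents as ordinals; it embeds the ordinals with their Hessenberg operations into a
  ring.\<close>

definition to_int_coefs :: "('a \<Rightarrow>\<^sub>0 nat) \<Rightarrow> 'a \<Rightarrow>\<^sub>0 int" where
  "to_int_coefs = Poly_Mapping.map int"

lemma lookup_to_int_coefs [simp]: "coef (to_int_coefs f) k = int (coef f k)"
  by (simp add: to_int_coefs_def map.rep_eq when_def)

lemma keys_to_int_coefs [simp]: "Poly_Mapping.keys (to_int_coefs f) = Poly_Mapping.keys f"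
  by (auto simp: in_keys_iff)

lemma to_int_coefs_zero [simp]: "to_int_coefs 0 = 0"
  by (rule poly_mapping_eqI) simp

lemma to_int_coefs_eq_iff [simp]: "to_int_coefs f = to_int_coefs g \<longleftrightarrow> f = g"
  by (simp add: poly_mapping_eq_iff fun_eq_iff)

lemma to_int_coefs_add [simp]: "to_int_coefs (f + g) = to_int_coefs f + to_int_coefs g"
  by (rule poly_mapping_eqI) (simp add: lookup_add)

lemma to_int_coefs_mult [simp]:
  fixes f g :: "'a::monoid_add \<Rightarrow>\<^sub>0 nat"
  shows "to_int_coefs (f * g) = to_int_coefs f * to_int_coefs g"
  by (rule poly_mapping_eqI) (simp add: lookup_mult_keys if_distrib cong: if_cong)

text \<open>Adding \<open>h\<close> preserves the set of exponents at which two normal forms differ,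
  and the comparison of the coefficients there.\<close>

lemma omega_exp_add_right:
  assumes "Poly_Mapping.keys h \<subseteq> Field s" "(f, g) \<in> omega_exp s"
  shows "(f + h, g + h) \<in> omega_exp s"
proof -
  have "Poly_Mapping.keys (f + h) \<subseteq> Field s" "Poly_Mapping.keys (g + h) \<subseteq> Field s"
    using assms keys_add[of f h] keys_add[of g h] by (auto simp: omega_exp_def)
  then show ?thesis using assms by (auto simp: omega_exp_def lookup_add)
qed

lemma omega_exp_add_right_cancel:
  assumes "(f + h, g + h) \<in> omega_exp s"
  shows "(f, g) \<in> omega_exp s"
proof -
  \<comment> \<open>Natural coefficients cannot cancel, so supports only grow under
    addition.\<close>
  have "Poly_Mapping.keys f \<subseteq> Poly_Mapping.keys (f + h)"
    "Poly_Mapping.keys g \<subseteq> Poly_Mapping.keys (g + h)"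
    by (auto simp: in_keys_iff lookup_add)
  then show ?thesis using assms by (auto simp: omega_exp_def lookup_add)
qed

text \<open>The witness \<open>x\<close> is itself in the support, so it is the leading exponent
  when \<open>r\<close> is antisymmetric. The formula is the strict clause of
  \<open>omega_exp\<close> expressed through a difference.\<close>

definition lead_pos :: "'m rel \<Rightarrow> ('m \<Rightarrow>\<^sub>0 int) \<Rightarrow> bool" where
  "lead_pos r p \<longleftrightarrow> (\<exists>x. 0 < coef p x \<and> (\<forall>y. coef p y \<noteq> 0 \<longrightarrow> (y, x) \<in> r))"

text \<open>Sums of exponents are strictly monotone in both arguments, so the sum of the leading
  exponents is the largest exponent of the product and arises from a single pair. Its coefficient is
  the product of the leading coefficients.\<close>

lemma lead_pos_mult:
  assumes s: "Well_order s"
    and p: "Poly_Mapping.keys p \<subseteq> Field (omega_exp s)" "lead_pos (omega_exp s) p"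
    and q: "Poly_Mapping.keys q \<subseteq> Field (omega_exp s)" "lead_pos (omega_exp s) q"
  shows "lead_pos (omega_exp s) (p * q)"
proof -
  have an: "antisym (omega_exp s)" and tr: "trans (omega_exp s)"
    using Well_order_omega_exp[OF s] by (auto simp: order_on_defs)
  from p(2) obtain x where x: "0 < coef p x" "\<And>y. coef p y \<noteq> 0 \<Longrightarrow> (y, x) \<in> omega_exp s"
    unfolding lead_pos_def by blast
  from q(2) obtain y where y: "0 < coef q y" "\<And>z. coef q z \<noteq> 0 \<Longrightarrow> (z, y) \<in> omega_exp s"
    unfolding lead_pos_def by blast
  have xk: "x \<in> Poly_Mapping.keys p" "y \<in> Poly_Mapping.keys q" using x(1) y(1) by (auto simp: in_keys_iff)
  have kp: "Poly_Mapping.keys l \<subseteq> Field s" if "l \<in> Poly_Mapping.keys p" for l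
    using that p(1) by (auto simp: Field_omega_exp)
  have ky: "Poly_Mapping.keys y \<subseteq> Field s"
    using xk(2) q(1) by (auto simp: Field_omega_exp)
  have le1: "(l + k, l + y) \<in> omega_exp s"
    if "l \<in> Poly_Mapping.keys p" "k \<in> Poly_Mapping.keys q" for l k
    using omega_exp_add_right[OF kp[OF that(1)] y(2)[of k]] that(2) by (simp add: in_keys_iff add.commute)
  have le2: "(l + y, x + y) \<in> omega_exp s" if "l \<in> Poly_Mapping.keys p" for l
    using omega_exp_add_right[OF ky x(2)[of l]] that by (simp add: in_keys_iff)
  have only: "x + y = l + k \<longleftrightarrow> l = x \<and> k = y"
    if lk: "l \<in> Poly_Mapping.keys p" "k \<in> Poly_Mapping.keys q" for l k
  proof
    assume e: "x + y = l + k"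
    \<comment> \<open>From x + y = l + k and k at most y, cancelling \<open>y\<close> gives x at
      most l, whereas \<open>x\<close> is the largest exponent of \<open>p\<close>.\<close>
    then have "(x + y, l + y) \<in> omega_exp s" using le1[OF lk] by simp
    then have "(x, l) \<in> omega_exp s" by (rule omega_exp_add_right_cancel)
    then have "l = x" using x(2)[of l] lk(1) an by (auto simp: in_keys_iff antisym_def)
    then show "l = x \<and> k = y" using e by simp
  qed simp
  have "coef (p * q) (x + y) = (\<Sum>l\<in>Poly_Mapping.keys p. \<Sum>k\<in>Poly_Mapping.keys q.
      if l = x then if k = y then coef p l * coef q k else 0 else 0)"
    unfolding lookup_mult_keys by (intro sum.cong refl) (simp add: only)
  also have "\<dots> = (\<Sum>l\<in>Poly_Mapping.keys p. if l = x then coef p x * coef q y else 0)"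
    using xk by (intro sum.cong refl) simp
  also have "\<dots> = coef p x * coef q y" using xk by simp
  finally have "0 < coef (p * q) (x + y)" using x y by simp
  moreover have "(z, x + y) \<in> omega_exp s" if "coef (p * q) z \<noteq> 0" for z
  proof -
    have "z \<in> Poly_Mapping.keys (p * q)" using that by (simp add: in_keys_iff)
    then obtain l k where "z = l + k" "l \<in> Poly_Mapping.keys p" "k \<in> Poly_Mapping.keys q"
      using keys_mult[of p q] by blast
    then show ?thesis using le1[of l k] le2[of l] tr by (auto dest: transD)
  qed
  ultimately show ?thesis unfolding lead_pos_def by blast
qed

lemma lead_pos_add:
  assumes r: "Well_order r"
    and p: "Poly_Mapping.keys p \<subseteq> Field r" "lead_pos r p"
    and q: "Poly_Mapping.keys q \<subseteq> Field r" "lead_pos r q"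
  shows "lead_pos r (p + q)"
proof -
  have an: "antisym r" and tr: "trans r" and tt: "Total r" and re: "Refl r"
    using r by (auto simp: order_on_defs)
  \<comment> \<open>The larger leading exponent \<open>y\<close> leads the sum: the coefficient of
    \<open>f\<close> there is zero, or positive in case x = y. Stated for arbitrary \<open>f\<close>
    and \<open>g\<close> to serve both orders of \<open>p\<close> and \<open>q\<close>.\<close>
  have main: "lead_pos r (f + g)"
    if x: "0 < coef f x" "\<And>z. coef f z \<noteq> 0 \<Longrightarrow> (z, x) \<in> r"
      and y: "0 < coef g y" "\<And>z. coef g z \<noteq> 0 \<Longrightarrow> (z, y) \<in> r" and xy: "(x, y) \<in> r" for f g x y
  proof -
    have "0 \<le> coef f y"
    proof (rule ccontr)
      assume "\<not> 0 \<le> coef f y"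
      then have "(y, x) \<in> r" using x(2) by simp
      then have "x = y" using xy an by (auto simp: antisym_def)
      then show False using x(1) \<open>\<not> 0 \<le> coef f y\<close> by simp
    qed
    moreover have "(z, y) \<in> r" if "coef f z + coef g z \<noteq> 0" for z
    proof -
      have "coef f z \<noteq> 0 \<or> coef g z \<noteq> 0" using that by auto
      then show ?thesis using x(2) y(2) xy tr by (meson transD)
    qed
    ultimately show ?thesis using y(1) unfolding lead_pos_def lookup_add by (intro exI[of _ y]) auto
  qed
  from p(2) obtain x where x: "0 < coef p x" "\<And>y. coef p y \<noteq> 0 \<Longrightarrow> (y, x) \<in> r"
    unfolding lead_pos_def by blast
  from q(2) obtain y where y: "0 < coef q y" "\<And>z. coef q z \<noteq> 0 \<Longrightarrow> (z, y) \<in> r"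
    unfolding lead_pos_def by blast
  have "x \<in> Poly_Mapping.keys p" "y \<in> Poly_Mapping.keys q"
    using x(1) y(1) by (auto simp: in_keys_iff)
  then have "x \<in> Field r" "y \<in> Field r" using p(1) q(1) by blast+
  then have "(x, y) \<in> r \<or> (y, x) \<in> r"
    using tt re by (cases "x = y") (auto simp: total_on_def refl_on_def)
  then show ?thesis using main[OF x y] main[OF y x] by (auto simp: add.commute)
qed

lemma lead_pos_cases:
  assumes "Well_order r" "Poly_Mapping.keys p \<subseteq> Field r"
  shows "p = 0 \<or> lead_pos r p \<or> lead_pos r (- p)"
proof (cases "p = 0")
  case False
  \<comment> \<open>The largest exponent at which \<open>p\<close> differs from 0 is its leading
    exponent.\<close>
  obtain x where x: "coef p x \<noteq> 0" "\<And>y. coef p y \<noteq> 0 \<Longrightarrow> (y, x) \<in> r"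
    using omega_exp_max_diff[of r p 0] assms False by auto
  then have "0 < coef p x \<or> 0 < coef (- p) x" by auto
  then show ?thesis using x(2) unfolding lead_pos_def by force
qed simp


section \<open>The integers and rationals of an ordinal\<close>

definition int_ring :: "'a rel \<Rightarrow> (('a \<Rightarrow>\<^sub>0 nat) \<Rightarrow>\<^sub>0 int) set" where
  "int_ring \<alpha> = {p. Poly_Mapping.keys p \<subseteq> Field (omega_exp \<alpha>)}"

text \<open>Exponents below \<open>\<omega>\<^sup>\<alpha>\<close> are closed under the natural sum.
  The general coefficients cover both the ordinals and the monoid ring over the integers.\<close>

lemma keys_mult_omega_exp:
  fixes p q :: "('a \<Rightarrow>\<^sub>0 nat) \<Rightarrow>\<^sub>0 'b::semiring_0"
  assumes "Poly_Mapping.keys p \<subseteq> Field (omega_exp s)" "Poly_Mapping.keys q \<subseteq> Field (omega_exp s)"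
  shows "Poly_Mapping.keys (p * q) \<subseteq> Field (omega_exp s)"
proof
  fix z assume "z \<in> Poly_Mapping.keys (p * q)"
  then obtain l k where "z = l + k" "l \<in> Poly_Mapping.keys p" "k \<in> Poly_Mapping.keys q"
    using keys_mult[of p q] by blast
  then show "z \<in> Field (omega_exp s)"
    using assms keys_add[of l k] unfolding Field_omega_exp by blast
qed

lemma positive_cone_int_ring:
  assumes "Well_order \<alpha>"
  shows "positive_cone (int_ring \<alpha>) (lead_pos (omega_exp \<alpha>))"
proof
  note w = Well_order_omega_exp[OF assms]
  fix x y :: "('a \<Rightarrow>\<^sub>0 nat) \<Rightarrow>\<^sub>0 int"
  show "\<not> lead_pos (omega_exp \<alpha>) (0 :: ('a \<Rightarrow>\<^sub>0 nat) \<Rightarrow>\<^sub>0 int)" by (simp add: lead_pos_def)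
  assume x: "x \<in> int_ring \<alpha>"
  then show "- x \<in> int_ring \<alpha>" by (simp add: int_ring_def)
  show "x = 0 \<or> lead_pos (omega_exp \<alpha>) x \<or> lead_pos (omega_exp \<alpha>) (- x)"
    using lead_pos_cases[OF w] x by (simp add: int_ring_def)
  assume y: "y \<in> int_ring \<alpha>"
  show "x + y \<in> int_ring \<alpha>" using x y keys_add[of x y] by (auto simp: int_ring_def)
  show "x * y \<in> int_ring \<alpha>" using x y keys_mult_omega_exp[of x \<alpha> y] by (simp add: int_ring_def)
  assume "lead_pos (omega_exp \<alpha>) x" "lead_pos (omega_exp \<alpha>) y"
  then show "lead_pos (omega_exp \<alpha>) (x + y)" "lead_pos (omega_exp \<alpha>) (x * y)"
    using x y by (simp_all add: int_ring_def lead_pos_add[OF w] lead_pos_mult[OF assms])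
qed

section \<open>Ordinals and integers as elements of the monoid ring\<close>

lemma ord_nats_keys: "ord_nats \<alpha> = {f. Poly_Mapping.keys f \<subseteq> Field (omega_exp \<alpha>)}"
  unfolding ord_nats_def by (rule Field_omega_exp)

lemma ord_nats_zero: "0 \<in> ord_nats \<alpha>"
  by (simp add: ord_nats_keys)

lemma ord_nats_add: "a \<in> ord_nats \<alpha> \<Longrightarrow> b \<in> ord_nats \<alpha> \<Longrightarrow> a + b \<in> ord_nats \<alpha>"
  using keys_add[of a b] by (auto simp: ord_nats_keys)

lemma ord_nats_mult: "a \<in> ord_nats \<alpha> \<Longrightarrow> b \<in> ord_nats \<alpha> \<Longrightarrow> a * b \<in> ord_nats \<alpha>"
  using keys_mult_omega_exp[of a \<alpha> b] by (simp add: ord_nats_keys)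

lemmas ord_nats_closed = ord_nats_zero ord_nats_add ord_nats_mult

text \<open>Operations on classes are unions over representatives; this reduces evaluating them to
  independence of the representatives.\<close>

lemma UN_const_on: "x \<in> A \<Longrightarrow> (\<And>y. y \<in> A \<Longrightarrow> f y = c) \<Longrightarrow> (\<Union>y\<in>A. f y) = c"
  by (rule SUP_eq_const) auto

text \<open>The class of (a, b) becomes the difference a - b in the monoid ring. The chosen
  representative does not matter, by \<open>int_val_class\<close>.\<close>

definition int_val :: "'a ord_int \<Rightarrow> ('a \<Rightarrow>\<^sub>0 nat) \<Rightarrow>\<^sub>0 int" where
  "int_val X = (let p = SOME p. p \<in> X in to_int_coefs (fst p) - to_int_coefs (snd p))"

text \<open>Since \<open>to_int_coefs\<close> is injective and additive, the defining equation may
  be rearranged in a ring, so being related means having equal differences.\<close>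

lemma int_rel_iff: "((a, b), (c, d)) \<in> int_rel \<alpha> \<longleftrightarrow>
  a \<in> ord_nats \<alpha> \<and> b \<in> ord_nats \<alpha> \<and> c \<in> ord_nats \<alpha> \<and> d \<in> ord_nats \<alpha> \<and>
  to_int_coefs a - to_int_coefs b = to_int_coefs c - to_int_coefs d"
proof -
  have "a + d = b + c \<longleftrightarrow> to_int_coefs (a + d) = to_int_coefs (b + c)"
    by (simp only: to_int_coefs_eq_iff)
  also have "\<dots> \<longleftrightarrow> to_int_coefs a - to_int_coefs b = to_int_coefs c - to_int_coefs d"
    by (simp add: algebra_simps)
  finally show ?thesis by (simp add: int_rel_def)
qed

lemma ord_int_cases:
  assumes "X \<in> ord_ints \<alpha>"
  obtains a b where "a \<in> ord_nats \<alpha>" "b \<in> ord_nats \<alpha>" "X = int_rel \<alpha> `` {(a, b)}"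
  using assms by (auto simp: ord_ints_def elim!: quotientE)

lemma int_class_in [simp]:
  "a \<in> ord_nats \<alpha> \<Longrightarrow> b \<in> ord_nats \<alpha> \<Longrightarrow> int_rel \<alpha> `` {(a, b)} \<in> ord_ints \<alpha>"
  by (auto simp: ord_ints_def intro: quotientI)

lemma int_class_self:
  "a \<in> ord_nats \<alpha> \<Longrightarrow> b \<in> ord_nats \<alpha> \<Longrightarrow> (a, b) \<in> int_rel \<alpha> `` {(a, b)}"
  by (simp add: int_rel_iff)

lemma int_class_eq_iff:
  assumes "a \<in> ord_nats \<alpha>" "b \<in> ord_nats \<alpha>" "c \<in> ord_nats \<alpha>" "d \<in> ord_nats \<alpha>"
  shows "int_rel \<alpha> `` {(a, b)} = int_rel \<alpha> `` {(c, d)} \<longleftrightarrow>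
    to_int_coefs a - to_int_coefs b = to_int_coefs c - to_int_coefs d"
proof
  assume "int_rel \<alpha> `` {(a, b)} = int_rel \<alpha> `` {(c, d)}"
  then have "(c, d) \<in> int_rel \<alpha> `` {(a, b)}" using int_class_self assms by blast
  then show "to_int_coefs a - to_int_coefs b = to_int_coefs c - to_int_coefs d"
    by (simp add: int_rel_iff)
qed (use assms in \<open>auto simp: int_rel_iff\<close>)

lemma int_val_class [simp]:
  assumes "a \<in> ord_nats \<alpha>" "b \<in> ord_nats \<alpha>"
  shows "int_val (int_rel \<alpha> `` {(a, b)}) = to_int_coefs a - to_int_coefs b"
proof -
  have "(SOME p. p \<in> int_rel \<alpha> `` {(a, b)}) \<in> int_rel \<alpha> `` {(a, b)}"
    using int_class_self[OF assms] by (rule someI)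
  then show ?thesis
    by (cases "SOME p. p \<in> int_rel \<alpha> `` {(a, b)}") (simp add: int_val_def int_rel_iff)
qed

lemma int_val_eq_iff:
  "X \<in> ord_ints \<alpha> \<Longrightarrow> Y \<in> ord_ints \<alpha> \<Longrightarrow> int_val X = int_val Y \<longleftrightarrow> X = Y"
  by (elim ord_int_cases) (simp add: int_class_eq_iff)

lemma int_val_in_ring: "X \<in> ord_ints \<alpha> \<Longrightarrow> int_val X \<in> int_ring \<alpha>"
proof (elim ord_int_cases)
  fix a b assume ab: "a \<in> ord_nats \<alpha>" "b \<in> ord_nats \<alpha>" and X: "X = int_rel \<alpha> `` {(a, b)}"
  then show ?thesis
    using keys_diff[of "to_int_coefs a" "to_int_coefs b"] by (auto simp: int_ring_def ord_nats_keys)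
qed

lemma int_zero_in: "int_zero \<alpha> \<in> ord_ints \<alpha>"
  by (simp add: int_zero_def ord_nats_zero)

lemma int_val_zero: "int_val (int_zero \<alpha>) = 0"
  by (simp add: int_zero_def ord_nats_zero)

lemma int_neg_class:
  assumes "a \<in> ord_nats \<alpha>" "b \<in> ord_nats \<alpha>"
  shows "int_neg \<alpha> (int_rel \<alpha> `` {(a, b)}) = int_rel \<alpha> `` {(b, a)}"
  unfolding int_neg_def
proof (rule UN_const_on[OF int_class_self[OF assms]], clarify)
  fix c d assume "((a, b), (c, d)) \<in> int_rel \<alpha>"
  then show "int_rel \<alpha> `` {(d, c)} = int_rel \<alpha> `` {(b, a)}"
    by (simp add: int_rel_iff int_class_eq_iff) (metis minus_diff_eq)
qed

lemma int_add_class: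
  assumes "a \<in> ord_nats \<alpha>" "b \<in> ord_nats \<alpha>" "c \<in> ord_nats \<alpha>" "d \<in> ord_nats \<alpha>"
  shows "int_add \<alpha> (int_rel \<alpha> `` {(a, b)}) (int_rel \<alpha> `` {(c, d)}) = int_rel \<alpha> `` {(a + c, b + d)}"
  unfolding int_add_def
proof (rule UN_const_on[OF int_class_self[OF assms(1,2)]], clarify,
    rule UN_const_on[OF int_class_self[OF assms(3,4)]], clarify)
  fix a' b' c' d' assume "((a, b), (a', b')) \<in> int_rel \<alpha>" "((c, d), (c', d')) \<in> int_rel \<alpha>"
  moreover have "to_int_coefs (e + g) - to_int_coefs (f + h) =
    (to_int_coefs e - to_int_coefs f) + (to_int_coefs g - to_int_coefs h)" for e f g h :: "'a ord_nat"
    by (simp add: algebra_simps)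
  ultimately show "int_rel \<alpha> `` {(a' + c', b' + d')} = int_rel \<alpha> `` {(a + c, b + d)}"
    by (subst int_class_eq_iff) (simp_all add: int_rel_iff ord_nats_add del: to_int_coefs_add)
qed

lemma int_mult_class:
  assumes "a \<in> ord_nats \<alpha>" "b \<in> ord_nats \<alpha>" "c \<in> ord_nats \<alpha>" "d \<in> ord_nats \<alpha>"
  shows "int_mult \<alpha> (int_rel \<alpha> `` {(a, b)}) (int_rel \<alpha> `` {(c, d)}) =
    int_rel \<alpha> `` {(a * c + b * d, a * d + b * c)}"
  unfolding int_mult_def
proof (rule UN_const_on[OF int_class_self[OF assms(1,2)]], clarify,
    rule UN_const_on[OF int_class_self[OF assms(3,4)]], clarify)
  fix a' b' c' d' assume *: "((a, b), (a', b')) \<in> int_rel \<alpha>" "((c, d), (c', d')) \<in> int_rel \<alpha>"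
  \<comment> \<open>The product formula for pairs expands (e - f)(g - h), so its value depends only
    on the values of the factors.\<close>
  have "to_int_coefs (e * g + f * h) - to_int_coefs (e * h + f * g) =
    (to_int_coefs e - to_int_coefs f) * (to_int_coefs g - to_int_coefs h)" for e f g h :: "'a ord_nat"
    by (simp add: algebra_simps)
  then show "int_rel \<alpha> `` {(a' * c' + b' * d', a' * d' + b' * c')} =
    int_rel \<alpha> `` {(a * c + b * d, a * d + b * c)}"
    using * by (subst int_class_eq_iff) (simp_all add: int_rel_iff ord_nats_closed del: to_int_coefs_add)
qed

lemma int_neg_in: "X \<in> ord_ints \<alpha> \<Longrightarrow> int_neg \<alpha> X \<in> ord_ints \<alpha>"
  by (auto elim!: ord_int_cases simp: int_neg_class)

lemma int_add_in: "X \<in> ord_ints \<alpha> \<Longrightarrow> Y \<in> ord_ints \<alpha> \<Longrightarrow> int_add \<alpha> X Y \<in> ord_ints \<alpha>"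
  by (auto elim!: ord_int_cases simp: int_add_class ord_nats_closed)

lemma int_mult_in: "X \<in> ord_ints \<alpha> \<Longrightarrow> Y \<in> ord_ints \<alpha> \<Longrightarrow> int_mult \<alpha> X Y \<in> ord_ints \<alpha>"
  by (auto elim!: ord_int_cases simp: int_mult_class ord_nats_closed)

lemma int_val_neg: "X \<in> ord_ints \<alpha> \<Longrightarrow> int_val (int_neg \<alpha> X) = - int_val X"
  by (auto elim!: ord_int_cases simp: int_neg_class)

lemma int_val_add:
  "X \<in> ord_ints \<alpha> \<Longrightarrow> Y \<in> ord_ints \<alpha> \<Longrightarrow> int_val (int_add \<alpha> X Y) = int_val X + int_val Y"
  by (auto elim!: ord_int_cases simp: int_add_class ord_nats_closed)

lemma int_val_mult:
  "X \<in> ord_ints \<alpha> \<Longrightarrow> Y \<in> ord_ints \<alpha> \<Longrightarrow> int_val (int_mult \<alpha> X Y) = int_val X * int_val Y"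
  by (auto elim!: ord_int_cases simp: int_mult_class ord_nats_closed) (simp add: algebra_simps)

lemmas int_ops = int_zero_in int_neg_in int_add_in int_mult_in
  int_val_zero int_val_neg int_val_add int_val_mult

text \<open>The largest exponent at which \<open>a\<close> and \<open>b\<close> differ is the
  leading exponent of b - a, and the sign of the coefficient there decides the comparison.\<close>

lemma nat_le_iff:
  assumes "a \<in> ord_nats \<alpha>" "b \<in> ord_nats \<alpha>"
  shows "nat_le \<alpha> a b \<longleftrightarrow> to_int_coefs b - to_int_coefs a = 0 \<or>
    lead_pos (omega_exp \<alpha>) (to_int_coefs b - to_int_coefs a)"
  using assms unfolding nat_le_def omega_exp_def[of "omega_exp \<alpha>"] ord_nats_keys lead_pos_def
  by (auto simp: lookup_minus eq_commute[of "coef b _"])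

lemma int_le_zero_iff:
  assumes "X \<in> ord_ints \<alpha>"
  shows "int_le \<alpha> (int_zero \<alpha>) X \<longleftrightarrow> int_val X = 0 \<or> lead_pos (omega_exp \<alpha>) (int_val X)"
proof -
  obtain a b where ab: "a \<in> ord_nats \<alpha>" "b \<in> ord_nats \<alpha>" and X: "X = int_rel \<alpha> `` {(a, b)}"
    using assms by (rule ord_int_cases)
  \<comment> \<open>The comparison has the same truth value for all representatives, so the
    existential quantifiers in \<open>int_le\<close> are harmless.\<close>
  have *: "nat_le \<alpha> (a2 + b1) (a1 + b2) \<longleftrightarrow> int_val X = 0 \<or> lead_pos (omega_exp \<alpha>) (int_val X)"
    if "(a1, a2) \<in> X" "(b1, b2) \<in> int_zero \<alpha>" for a1 a2 b1 b2
  proof -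
    have "to_int_coefs (a1 + b2) - to_int_coefs (a2 + b1) = int_val X"
      using that ab by (simp add: X int_zero_def int_rel_iff)
    moreover have "a2 + b1 \<in> ord_nats \<alpha>" "a1 + b2 \<in> ord_nats \<alpha>"
      using that by (auto simp: X int_zero_def int_rel_iff ord_nats_add)
    ultimately show ?thesis using nat_le_iff by metis
  qed
  have "(a, b) \<in> X" "(0, 0) \<in> int_zero \<alpha>"
    using ab by (simp_all add: X int_zero_def int_rel_iff ord_nats_zero)
  then show ?thesis using * unfolding int_le_def by blast
qed

section \<open>Rationals as fractions over the monoid ring\<close>

context
  fixes \<alpha> :: "'a rel"
  assumes wo: "Well_order \<alpha>"
begin

interpretation positive_cone "int_ring \<alpha>" "lead_pos (omega_exp \<alpha>)"
  using wo by (rule positive_cone_int_ring)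

definition frac_val :: "'a ord_int \<times> 'a ord_int \<Rightarrow>
    (('a \<Rightarrow>\<^sub>0 nat) \<Rightarrow>\<^sub>0 int) \<times> (('a \<Rightarrow>\<^sub>0 nat) \<Rightarrow>\<^sub>0 int)" where
  "frac_val = map_prod int_val int_val"

definition rat_reps :: "('a ord_int \<times> 'a ord_int) set" where
  "rat_reps = ord_ints \<alpha> \<times> (ord_ints \<alpha> - {int_zero \<alpha>})"

lemma rat_reps_iff:
  "(a, b) \<in> rat_reps \<longleftrightarrow> a \<in> ord_ints \<alpha> \<and> b \<in> ord_ints \<alpha> \<and> int_val b \<noteq> 0"
  using int_val_eq_iff[OF _ int_zero_in] by (auto simp: rat_reps_def int_val_zero)

lemma frac_val_in: "x \<in> rat_reps \<Longrightarrow> frac_val x \<in> fractions"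
  by (cases x) (simp add: rat_reps_iff frac_val_def fractions_def int_val_in_ring)

lemma rat_rel_iff: "((a, b), (c, d)) \<in> rat_rel \<alpha> \<longleftrightarrow>
  (a, b) \<in> rat_reps \<and> (c, d) \<in> rat_reps \<and> int_val a * int_val d = int_val b * int_val c"
proof -
  have "int_mult \<alpha> a d = int_mult \<alpha> b c \<longleftrightarrow> int_val a * int_val d = int_val b * int_val c"
    if "a \<in> ord_ints \<alpha>" "b \<in> ord_ints \<alpha>" "c \<in> ord_ints \<alpha>" "d \<in> ord_ints \<alpha>"
    using int_val_eq_iff[of "int_mult \<alpha> a d" \<alpha> "int_mult \<alpha> b c"] that by (simp add: int_ops)
  then show ?thesis by (auto simp: rat_rel_def rat_reps_def)
qed

lemma int_val_mult_nonzero: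
  assumes "b \<in> ord_ints \<alpha>" "int_val b \<noteq> 0" "d \<in> ord_ints \<alpha>" "int_val d \<noteq> 0"
  shows "int_val b * int_val d \<noteq> 0"
  using mult_eq_zero[of "int_val b" "int_val d"] assms by (auto simp: int_val_in_ring)

lemma int_val_mult_cancel:
  assumes "x \<in> int_ring \<alpha>" "y \<in> int_ring \<alpha>" "d \<in> ord_ints \<alpha>" "int_val d \<noteq> 0"
    "int_val d * x = int_val d * y"
  shows "x = y"
  using mult_eq_zero[of "int_val d" "x - y"] assms
  by (auto simp: int_val_in_ring diff_closed algebra_simps)

text \<open>Transitivity is the point where the absence of zero divisors enters: the middle
  denominator has to be cancelled.\<close>

lemma equiv_rat_rel: "equiv rat_reps (rat_rel \<alpha>)"
proof (rule equivI)
  show "rat_rel \<alpha> \<subseteq> rat_reps \<times> rat_reps" by (auto simp: rat_rel_iff)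
  show "refl_on rat_reps (rat_rel \<alpha>)" by (auto simp: refl_on_def rat_rel_iff mult.commute)
  show "sym (rat_rel \<alpha>)" by (auto simp: sym_def rat_rel_iff mult.commute)
  show "trans (rat_rel \<alpha>)"
  proof (rule transI, clarify)
    fix a b c d e f
    assume *: "((a, b), (c, d)) \<in> rat_rel \<alpha>" "((c, d), (e, f)) \<in> rat_rel \<alpha>"
    have "int_val d * (int_val a * int_val f) = int_val a * int_val d * int_val f"
      by (simp add: algebra_simps)
    also have "\<dots> = int_val b * (int_val c * int_val f)"
      using *(1) by (simp add: rat_rel_iff mult.assoc)
    also have "\<dots> = int_val d * (int_val b * int_val e)"
      using *(2) by (simp add: rat_rel_iff algebra_simps)
    finally have "int_val a * int_val f = int_val b * int_val e"
      using int_val_mult_cancel[of "int_val a * int_val f" "int_val b * int_val e" d] *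
      by (simp add: rat_rel_iff rat_reps_iff int_val_in_ring mult_closed)
    then show "((a, b), (e, f)) \<in> rat_rel \<alpha>" using * by (simp add: rat_rel_iff)
  qed
qed

lemma ord_rat_cases:
  assumes "X \<in> ord_rats \<alpha>"
  obtains a b where "(a, b) \<in> rat_reps" "X = rat_rel \<alpha> `` {(a, b)}"
  using assms by (auto simp: ord_rats_def rat_reps_def elim!: quotientE)

lemma rat_class_in: "x \<in> rat_reps \<Longrightarrow> rat_rel \<alpha> `` {x} \<in> ord_rats \<alpha>"
  by (auto simp: ord_rats_def rat_reps_def intro: quotientI)

lemma rat_class_eq_iff:
  assumes "(a, b) \<in> rat_reps" "(c, d) \<in> rat_reps"
  shows "rat_rel \<alpha> `` {(a, b)} = rat_rel \<alpha> `` {(c, d)} \<longleftrightarrow>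
    int_val a * int_val d = int_val b * int_val c"
  using eq_equiv_class_iff[OF equiv_rat_rel assms] assms by (simp add: rat_rel_iff)

lemma rat_neg_class:
  assumes "(a, b) \<in> rat_reps"
  shows "rat_neg \<alpha> (rat_rel \<alpha> `` {(a, b)}) = rat_rel \<alpha> `` {(int_neg \<alpha> a, b)}"
  unfolding rat_neg_def
proof (rule UN_const_on[OF equiv_class_self[OF equiv_rat_rel assms]], clarify)
  fix c d assume "((a, b), (c, d)) \<in> rat_rel \<alpha>"
  then show "rat_rel \<alpha> `` {(int_neg \<alpha> c, d)} = rat_rel \<alpha> `` {(int_neg \<alpha> a, b)}"
    by (subst rat_class_eq_iff) (auto simp: rat_rel_iff rat_reps_iff int_ops mult.commute)
qed

lemma rat_add_class:
  assumes "(a, b) \<in> rat_reps" "(c, d) \<in> rat_reps"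
  shows "rat_add \<alpha> (rat_rel \<alpha> `` {(a, b)}) (rat_rel \<alpha> `` {(c, d)}) =
    rat_rel \<alpha> `` {(int_add \<alpha> (int_mult \<alpha> a d) (int_mult \<alpha> b c), int_mult \<alpha> b d)}"
  unfolding rat_add_def
proof (rule UN_const_on[OF equiv_class_self[OF equiv_rat_rel assms(1)]], clarify,
    rule UN_const_on[OF equiv_class_self[OF equiv_rat_rel assms(2)]], clarify)
  fix a' b' c' d'
  assume *: "((a, b), (a', b')) \<in> rat_rel \<alpha>" "((c, d), (c', d')) \<in> rat_rel \<alpha>"
  \<comment> \<open>Equality of p/q + r/s and p'/q' + r'/s' after cross-multiplication, given p/q =
    p'/q' and r/s = r'/s'.\<close>
  have e: "(p' * s' + q' * r') * (q * s) = (q' * s') * (p * s + q * r)"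
    if "p * q' = q * p'" "r * s' = s * r'" for p q r s p' q' r' s' :: "('a \<Rightarrow>\<^sub>0 nat) \<Rightarrow>\<^sub>0 int"
  proof -
    have "(p' * s' + q' * r') * (q * s) = (q * p') * (s * s') + (s * r') * (q * q')"
      by (simp add: algebra_simps)
    also have "\<dots> = (p * q') * (s * s') + (r * s') * (q * q')" using that by simp
    also have "\<dots> = (q' * s') * (p * s + q * r)" by (simp add: algebra_simps)
    finally show ?thesis .
  qed
  show "rat_rel \<alpha> `` {(int_add \<alpha> (int_mult \<alpha> a' d') (int_mult \<alpha> b' c'), int_mult \<alpha> b' d')} =
    rat_rel \<alpha> `` {(int_add \<alpha> (int_mult \<alpha> a d) (int_mult \<alpha> b c), int_mult \<alpha> b d)}"
    using * by (subst rat_class_eq_iff)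
      (auto simp: rat_rel_iff rat_reps_iff int_ops int_val_mult_nonzero e)
qed

text \<open>The sign does not depend on the representative: if ad = bc, then ab times the square of
  d equals cd times the square of b, and the square of d can be cancelled.\<close>

lemma rat_nonneg_class:
  assumes "(a, b) \<in> rat_reps"
  shows "rat_nonneg \<alpha> (rat_rel \<alpha> `` {(a, b)}) \<longleftrightarrow> nonneg (int_val a * int_val b)"
proof -
  have le: "int_le \<alpha> (int_zero \<alpha>) (int_mult \<alpha> c d) \<longleftrightarrow> nonneg (int_val c * int_val d)"
    if "(c, d) \<in> rat_reps" for c d
    using that by (simp add: rat_reps_iff int_le_zero_iff int_ops nonneg_def)
  have imp: "nonneg (int_val a * int_val b)"
    if cd: "((a, b), (c, d)) \<in> rat_rel \<alpha>" and n: "nonneg (int_val c * int_val d)" for c d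
  proof -
    have D: "int_val a \<in> int_ring \<alpha>" "int_val b \<in> int_ring \<alpha>" "int_val c \<in> int_ring \<alpha>"
      "int_val d \<in> int_ring \<alpha>" "int_val d \<noteq> 0" "int_val a * int_val d = int_val b * int_val c"
      using cd by (auto simp: rat_rel_iff rat_reps_iff int_val_in_ring)
    have "int_val d * int_val d * (int_val a * int_val b) =
      int_val a * int_val d * (int_val b * int_val d)" by (simp add: algebra_simps)
    also have "\<dots> = int_val b * int_val b * (int_val c * int_val d)"
      unfolding D(6) by (simp add: algebra_simps)
    finally have "nonneg (int_val d * int_val d * (int_val a * int_val b))"
      using n D by (simp add: nonneg_mult nonneg_square mult_closed)
    then show ?thesis using D nonneg_square_cancel mult_closed by blast
  qed
  show ?thesis
  proof
    assume "rat_nonneg \<alpha> (rat_rel \<alpha> `` {(a, b)})"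
    then obtain c d where "((a, b), (c, d)) \<in> rat_rel \<alpha>" "int_le \<alpha> (int_zero \<alpha>) (int_mult \<alpha> c d)"
      by (auto simp: rat_nonneg_def)
    then show "nonneg (int_val a * int_val b)" using imp le by (auto simp: rat_rel_iff)
  next
    assume "nonneg (int_val a * int_val b)"
    then show "rat_nonneg \<alpha> (rat_rel \<alpha> `` {(a, b)})"
      using equiv_class_self[OF equiv_rat_rel assms] le[OF assms] unfolding rat_nonneg_def by blast
  qed
qed

text \<open>Carries the order of classes over to \<open>frac_le\<close>: the numerator times the
  denominator of the difference is exactly the element that \<open>frac_le\<close> tests.\<close>

lemma rat_le_class:
  assumes "x \<in> rat_reps" "y \<in> rat_reps"
  shows "rat_rel \<alpha> `` {x} \<sqsubseteq>\<^bsub>rat_order \<alpha>\<^esub> rat_rel \<alpha> `` {y} \<longleftrightarrow> frac_le (frac_val x) (frac_val y)"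
proof -
  obtain a b c d where xy: "x = (c, d)" "y = (a, b)" by (cases x, cases y)
  have r: "a \<in> ord_ints \<alpha>" "b \<in> ord_ints \<alpha>" "c \<in> ord_ints \<alpha>" "d \<in> ord_ints \<alpha>"
    "int_val b \<noteq> 0" "int_val d \<noteq> 0" using assms by (auto simp: xy rat_reps_iff)
  have n: "(int_neg \<alpha> c, d) \<in> rat_reps" using r by (simp add: rat_reps_iff int_ops)
  have s: "(int_add \<alpha> (int_mult \<alpha> a d) (int_mult \<alpha> b (int_neg \<alpha> c)), int_mult \<alpha> b d) \<in> rat_reps"
    using r by (simp add: rat_reps_iff int_ops int_val_mult_nonzero)
  have "rat_rel \<alpha> `` {x} \<sqsubseteq>\<^bsub>rat_order \<alpha>\<^esub> rat_rel \<alpha> `` {y} \<longleftrightarrow>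
    rat_nonneg \<alpha> (rat_add \<alpha> (rat_rel \<alpha> `` {(a, b)}) (rat_neg \<alpha> (rat_rel \<alpha> `` {(c, d)})))"
    by (simp add: rat_order_def xy)
  also have "\<dots> \<longleftrightarrow> nonneg ((int_val a * int_val d - int_val b * int_val c) * (int_val b * int_val d))"
    using assms n s r by (simp add: xy rat_neg_class rat_add_class rat_nonneg_class int_ops)
  finally show ?thesis by (simp add: xy frac_val_def mult.commute)
qed

text \<open>The four claims are in the shape and order of the premises of
  \<open>Union_lower_parts_cut\<close>.\<close>

lemma rat_order_dense_linear:
  shows "x \<in> ord_rats \<alpha> \<Longrightarrow> y \<in> ord_rats \<alpha> \<Longrightarrow> x \<sqsubseteq>\<^bsub>rat_order \<alpha>\<^esub> y \<or> y \<sqsubseteq>\<^bsub>rat_order \<alpha>\<^esub> x"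
    and "x \<in> ord_rats \<alpha> \<Longrightarrow> y \<in> ord_rats \<alpha> \<Longrightarrow>
      x \<sqsubseteq>\<^bsub>rat_order \<alpha>\<^esub> y \<Longrightarrow> y \<sqsubseteq>\<^bsub>rat_order \<alpha>\<^esub> x \<Longrightarrow> x = y"
    and "x \<in> ord_rats \<alpha> \<Longrightarrow> y \<in> ord_rats \<alpha> \<Longrightarrow> z \<in> ord_rats \<alpha> \<Longrightarrow>
      x \<sqsubseteq>\<^bsub>rat_order \<alpha>\<^esub> y \<Longrightarrow> y \<sqsubseteq>\<^bsub>rat_order \<alpha>\<^esub> z \<Longrightarrow> x \<sqsubseteq>\<^bsub>rat_order \<alpha>\<^esub> z"
    and "x \<in> ord_rats \<alpha> \<Longrightarrow> y \<in> ord_rats \<alpha> \<Longrightarrow> x \<sqsubseteq>\<^bsub>rat_order \<alpha>\<^esub> y \<Longrightarrow> x \<noteq> y \<Longrightarrow>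
      \<exists>z\<in>ord_rats \<alpha>. x \<sqsubseteq>\<^bsub>rat_order \<alpha>\<^esub> z \<and> z \<sqsubseteq>\<^bsub>rat_order \<alpha>\<^esub> y \<and> z \<noteq> x \<and> z \<noteq> y"
proof -
  assume x: "x \<in> ord_rats \<alpha>" and y: "y \<in> ord_rats \<alpha>"
  obtain a b where xr: "(a, b) \<in> rat_reps" and xe: "x = rat_rel \<alpha> `` {(a, b)}"
    using x by (rule ord_rat_cases)
  obtain c d where yr: "(c, d) \<in> rat_reps" and ye: "y = rat_rel \<alpha> `` {(c, d)}"
    using y by (rule ord_rat_cases)
  note fr = frac_val_in[OF xr] frac_val_in[OF yr]
  show "x \<sqsubseteq>\<^bsub>rat_order \<alpha>\<^esub> y \<or> y \<sqsubseteq>\<^bsub>rat_order \<alpha>\<^esub> x"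
    using frac_le_total[OF fr] by (simp add: xe ye rat_le_class xr yr)
  show "x = y" if "x \<sqsubseteq>\<^bsub>rat_order \<alpha>\<^esub> y" "y \<sqsubseteq>\<^bsub>rat_order \<alpha>\<^esub> x"
    using that frac_le_antisym[of "int_val a" "int_val b" "int_val c" "int_val d"] fr
    unfolding xe ye rat_le_class[OF xr yr] rat_le_class[OF yr xr] rat_class_eq_iff[OF xr yr]
    by (simp add: frac_val_def)
  show "x \<sqsubseteq>\<^bsub>rat_order \<alpha>\<^esub> z"
    if z: "z \<in> ord_rats \<alpha>" and le: "x \<sqsubseteq>\<^bsub>rat_order \<alpha>\<^esub> y" "y \<sqsubseteq>\<^bsub>rat_order \<alpha>\<^esub> z"
  proof -
    obtain e f where zr: "(e, f) \<in> rat_reps" and ze: "z = rat_rel \<alpha> `` {(e, f)}"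
      using z by (rule ord_rat_cases)
    show ?thesis
      using le frac_le_trans[OF fr frac_val_in[OF zr]] by (simp add: xe ye ze rat_le_class xr yr zr)
  qed
  show "\<exists>z\<in>ord_rats \<alpha>. x \<sqsubseteq>\<^bsub>rat_order \<alpha>\<^esub> z \<and> z \<sqsubseteq>\<^bsub>rat_order \<alpha>\<^esub> y \<and> z \<noteq> x \<and> z \<noteq> y"
    if le: "x \<sqsubseteq>\<^bsub>rat_order \<alpha>\<^esub> y" and ne: "x \<noteq> y"
  proof -
    \<comment> \<open>The midpoint is built with the operations on \<open>ord_ints\<close>, so that
      it represents a rational; its value is the fraction of \<open>frac_midpoint\<close>.\<close>
    define m n where "m = int_add \<alpha> (int_mult \<alpha> a d) (int_mult \<alpha> b c)"
      and "n = int_add \<alpha> (int_mult \<alpha> b d) (int_mult \<alpha> b d)"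
    have r: "a \<in> ord_ints \<alpha>" "b \<in> ord_ints \<alpha>" "c \<in> ord_ints \<alpha>" "d \<in> ord_ints \<alpha>"
      using xr yr by (auto simp: rat_reps_iff)
    have v: "int_val m = int_val a * int_val d + int_val b * int_val c"
      "int_val n = int_val b * int_val d + int_val b * int_val d"
      and mn: "m \<in> ord_ints \<alpha>" "n \<in> ord_ints \<alpha>"
      using r by (simp_all add: m_def n_def int_ops)
    note mid = frac_midpoint[of "int_val a" "int_val b" "int_val c" "int_val d", folded v]
    have prem: "(int_val a, int_val b) \<in> fractions" "(int_val c, int_val d) \<in> fractions"
      "frac_le (int_val a, int_val b) (int_val c, int_val d)"
      "int_val a * int_val d \<noteq> int_val b * int_val c"
      using fr le ne by (simp_all add: xe ye rat_le_class xr yr rat_class_eq_iff frac_val_def)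
    have zr: "(m, n) \<in> rat_reps"
      using mid(1)[OF prem] mn by (simp add: rat_reps_iff fractions_def)
    show ?thesis
    proof (intro bexI[of _ "rat_rel \<alpha> `` {(m, n)}"] conjI rat_class_in zr)
      show "x \<sqsubseteq>\<^bsub>rat_order \<alpha>\<^esub> rat_rel \<alpha> `` {(m, n)}" "rat_rel \<alpha> `` {(m, n)} \<sqsubseteq>\<^bsub>rat_order \<alpha>\<^esub> y"
        unfolding xe ye rat_le_class[OF xr zr] rat_le_class[OF zr yr]
        using mid(2,3)[OF prem] by (simp_all add: frac_val_def)
      show "rat_rel \<alpha> `` {(m, n)} \<noteq> x" "rat_rel \<alpha> `` {(m, n)} \<noteq> y"
        unfolding xe ye rat_class_eq_iff[OF zr xr] rat_class_eq_iff[OF zr yr]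
        using mid(4,5)[OF prem] .
    qed
  qed
qed

end

section \<open>Suprema and infima of sets of cuts on the rationals of \<alpha>\<close>

theorem mainTheorem2:
  fixes \<alpha> :: "'a rel" and S :: "('a ord_rat set \<times> 'a ord_rat set) set"
  assumes "Well_order \<alpha>"
    and "S \<subseteq> carrier (ord_reals \<alpha>)"
    and "Upper (ord_reals \<alpha>) S \<noteq> {}" and "Lower (ord_reals \<alpha>) S \<noteq> {}"
  shows "(\<exists>s\<in>carrier (ord_reals \<alpha>). least (ord_reals \<alpha>) s (Upper (ord_reals \<alpha>) S)) \<and>
    (\<exists>i\<in>carrier (ord_reals \<alpha>). greatest (ord_reals \<alpha>) i (Lower (ord_reals \<alpha>) S))"
proof -
  have eq: "eq (rat_order \<alpha>) = (=)" and carrier: "ord_rats \<alpha> = carrier (rat_order \<alpha>)"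
    by (simp_all add: rat_order_def)
  note dense_linear = rat_order_dense_linear[OF assms(1), unfolded carrier]
  have "\<exists>B. dedekind_cut (rat_order \<alpha>) (\<Union>(fst ` T)) B"
    if "T \<subseteq> carrier (cut_order (rat_order \<alpha>))" for T
    by (rule Union_lower_parts_cut[OF eq dense_linear])
      (use that in \<open>auto simp: cut_order_def\<close>)
  then show ?thesis
    using cut_order_complete[of "rat_order \<alpha>" S] assms(2) unfolding ord_reals_def by blast
qed

end
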